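(* Let $(X,T)$ be a minimal Cantor system, let $p:X\to\mathbb{Z}^+$ be a bounded function such that $S(x)=T^{p(x)}(x)$ defines a homeomorphism $S:X\to X$, and suppose that $S$ is minimal. Then the topological entropy of $S$ satisfies $$c\cdot h(T)\le h(S)\le\left(\sup_{\mu\in M(X,S)}\int p\,d\mu\right)h(T),$$ where $c$ is the orbit number of the speedup.
   Context: A minimal Cantor system is a pair $(X,T)$ with $X$ a Cantor space and $T:X\to X$ a homeomorphism all of whose orbits are dense. $h(\cdot)$ denotes topological entropy and $M(X,S)$ denotes the set of $S$-invariant Borel probability measures on $X$. Orbit number: for such a bounded speedup $S$ of $T$, there is a constant $c\in\mathbb{Z}^+$ such that every $T$-orbit is the union of exactly $c$ different $S$-orbits; $c$ is called the orbit number. (The supremum above is attained.) *)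

theory Defs
  imports "HOL-Probability.Probability"
begin

text \<open>
  The phase space is the carrier of a type of class \<open>topological_space\<close>.
\<close>

definition cantor_space :: "'a::topological_space itself \<Rightarrow> bool" where
  "cantor_space _ \<longleftrightarrow>
     (euclidean :: 'a topology) homeomorphic_space
       product_topology (\<lambda>_::nat. discrete_topology (UNIV :: bool set)) UNIV"

text \<open>Orbits are two-sided; \<open>inv T\<close> is meaningful because \<open>T\<close> is always a bijection below.\<close>

definition full_orbit :: "('a \<Rightarrow> 'a) \<Rightarrow> 'a \<Rightarrow> 'a set" where
  "full_orbit T x = range (\<lambda>n. (T ^^ n) x) \<union> range (\<lambda>n. (inv T ^^ n) x)"

definition all_orbits_dense :: "('a::topological_space \<Rightarrow> 'a) \<Rightarrow> bool" where
  "all_orbits_dense T \<longleftrightarrow> (\<forall>x. closure (full_orbit T x) = UNIV)"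

definition minimal_cantor_system :: "('a::topological_space \<Rightarrow> 'a) \<Rightarrow> bool" where
  "minimal_cantor_system T \<longleftrightarrow>
     cantor_space TYPE('a) \<and> homeomorphic_map euclidean euclidean T \<and> all_orbits_dense T"

definition speedup :: "('a \<Rightarrow> 'a) \<Rightarrow> ('a \<Rightarrow> nat) \<Rightarrow> 'a \<Rightarrow> 'a" where
  "speedup T p x = (T ^^ p x) x"

definition is_orbit_number :: "('a \<Rightarrow> 'a) \<Rightarrow> ('a \<Rightarrow> 'a) \<Rightarrow> nat \<Rightarrow> bool" where
  "is_orbit_number T S c \<longleftrightarrow>
     c > 0 \<and>
     (\<forall>x. \<exists>F \<subseteq> range (full_orbit S). finite F \<and> card F = c \<and> full_orbit T x = \<Union> F)"

definition orbit_number :: "('a \<Rightarrow> 'a) \<Rightarrow> ('a \<Rightarrow> 'a) \<Rightarrow> nat" where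
  "orbit_number T S = (THE c. is_orbit_number T S c)"

text \<open>Topological entropy of a continuous map of a compact space, via open covers.\<close>

definition open_cover :: "'a::topological_space set set \<Rightarrow> bool" where
  "open_cover \<U> \<longleftrightarrow> (\<forall>U\<in>\<U>. open U) \<and> \<Union> \<U> = UNIV"

definition min_subcover_card :: "'a set set \<Rightarrow> nat" where
  "min_subcover_card \<U> = (LEAST n. \<exists>\<V> \<subseteq> \<U>. finite \<V> \<and> card \<V> = n \<and> \<Union> \<V> = UNIV)"

text \<open>The join of the covers \<open>T\<^sup>-\<^sup>i \<U>\<close> for \<open>i < n\<close>; for \<open>n = 0\<close> it is \<open>{UNIV}\<close>.\<close>

definition cover_join :: "('a \<Rightarrow> 'a) \<Rightarrow> 'a set set \<Rightarrow> nat \<Rightarrow> 'a set set" where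
  "cover_join T \<U> n =
     {(\<Inter>i<n. (T ^^ i) -` U i) |U :: nat \<Rightarrow> 'a set. \<forall>i<n. U i \<in> \<U>}"

text \<open>
  The limit of the sequence below exists by subadditivity, so \<open>limsup\<close> is that limit.
\<close>

definition cover_entropy :: "('a \<Rightarrow> 'a) \<Rightarrow> 'a set set \<Rightarrow> ereal" where
  "cover_entropy T \<U> =
     limsup (\<lambda>n. ereal (ln (real (min_subcover_card (cover_join T \<U> n))) / real n))"

definition topological_entropy :: "('a::topological_space \<Rightarrow> 'a) \<Rightarrow> ereal" where
  "topological_entropy T = (SUP \<U> \<in> Collect open_cover. cover_entropy T \<U>)"

definition invariant_measures :: "('a::topological_space \<Rightarrow> 'a) \<Rightarrow> 'a measure set" where
  "invariant_measures S = {\<mu>. prob_space \<mu> \<and> sets \<mu> = sets borel \<and> distr \<mu> borel S = \<mu>}"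

end

theory Submission
  imports Defs
begin

text \<open>
  Both inequalities are proved by counting open covers; measure-theoretic entropy and the
  variational principle are avoided. Write \<open>S\<close> for the speedup and
  \<open>p\<^sub>n(x) = p(x) + p(Sx) + \<dots> + p(S\<^sup>n\<^sup>-\<^sup>1x)\<close>, so that \<open>S\<^sup>n x\<close> is \<open>T\<close> applied \<open>p\<^sub>n(x)\<close> times to \<open>x\<close>. As \<open>T\<close> is
  aperiodic, \<open>p = k\<close> means \<open>Sx = T\<^sup>kx\<close>, a closed condition, so the bounded function \<open>p\<close> is locally
  constant. A cover \<open>\<U>\<close> therefore has a refinement \<open>\<U>'\<close> by open sets on which \<open>p\<close> is constant and
  whose images under \<open>T\<^sup>r\<close>, for \<open>r\<close> below the bound \<open>P\<close> of \<open>p\<close>, each lie in a member of \<open>\<U>\<close>.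
  An \<open>S\<close>-name of \<open>y\<close> of length \<open>n\<close> in \<open>\<U>'\<close> determines a \<open>T\<close>-name of \<open>y\<close> of length \<open>p\<^sub>n(y)\<close> in
  \<open>\<U>\<close>, and conversely a long enough \<open>T\<close>-name in \<open>\<U>'\<close> determines an \<open>S\<close>-name in \<open>\<U>\<close>.
  
  Lower bound. Identify the \<open>T\<close>-orbit of \<open>x\<close> with the integers, \<open>x\<close> being \<open>0\<close>. Each \<open>S\<close>-orbit
  inside it runs to infinity in both directions, and so jumps exactly once from a position
  \<open>-j \<le> 0\<close> to a positive one. The orbit number \<open>c\<close> thus counts these jumps
  (\<open>orbit_number_eq_card_crossings\<close>); the count is locally constant and constant on \<open>T\<close>-orbits, so
  it does not depend on \<open>x\<close>. The \<open>c\<close> points from which the jumps start have \<open>c n\<close> distinct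
  images under \<open>S, \<dots>, S\<^sup>n\<close>. When \<open>m \<le> c n\<close> these do not all fit in the \<open>m - 1\<close> positions
  strictly between \<open>0\<close> and \<open>m\<close>, so one starting point has \<open>p\<^sub>n \<ge> m + j\<close> (\<open>long_crossing\<close>), and
  its \<open>S\<close>-name of length \<open>n\<close>, together with \<open>j < P\<close>, determines the \<open>T\<close>-name of \<open>x\<close> of length
  \<open>m\<close>. Hence the number of \<open>T\<close>-names of length \<open>m\<close> is at most \<open>P\<close> times the number of \<open>S\<close>-names of
  length about \<open>m / c\<close>, which yields \<open>h(T) \<le> h(S) / c\<close>.
  
  Upper bound. If \<open>p\<^sub>n \<le> \<kappa> n\<close> everywhere for all large \<open>n\<close>, then \<open>T\<close>-names of length \<open>\<kappa> n\<close>
  determine \<open>S\<close>-names of length \<open>n\<close>, and \<open>h(S) \<le> \<kappa> h(T)\<close> (\<open>entropy_S_le\<close>). If that hypothesis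
  fails, then averages of \<open>p\<close> over arbitrarily long \<open>S\<close>-orbit segments are at least \<open>\<kappa>\<close>, and a
  limit of the empirical measures of these segments is an \<open>S\<close>-invariant probability measure with
  \<open>\<integral>p d\<mu> \<ge> \<kappa>\<close> (\<open>invariant_measure_with_large_integral\<close>). So every \<open>\<kappa>\<close> above the supremum of the
  integrals is admissible.
\<close>

section \<open>Cantor spaces\<close>

lemma cantor_space_compact:
  assumes "cantor_space TYPE('a::topological_space)"
  shows "compact (UNIV :: 'a set)"
proof -
  have "compact_space (euclidean :: 'a topology)"
    using assms unfolding cantor_space_def
    by (simp add: homeomorphic_compact_space compact_space_product_topology
        compact_space_discrete_topology)
  then show ?thesis
    by (simp add: compact_space_def)
qed

lemma cantor_space_Hausdorff:
  assumes "cantor_space TYPE('a::topological_space)"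
  shows "Hausdorff_space (euclidean :: 'a topology)"
  using assms unfolding cantor_space_def
  by (simp add: homeomorphic_Hausdorff_space Hausdorff_space_product_topology)

lemma cantor_space_infinite:
  assumes "cantor_space TYPE('a::topological_space)"
  shows "infinite (UNIV :: 'a set)"
proof
  assume fin: "finite (UNIV :: 'a set)"
  obtain h :: "'a \<Rightarrow> nat \<Rightarrow> bool" where
    h: "homeomorphic_map euclidean (product_topology (\<lambda>_. discrete_topology UNIV) UNIV) h"
    using assms unfolding cantor_space_def homeomorphic_space by blast
  then have "range h = UNIV"
    using homeomorphic_imp_surjective_map[OF h] by (simp add: PiE_UNIV_domain)
  then have "finite (UNIV :: (nat \<Rightarrow> bool) set)"
    using fin by (metis finite_imageI)
  then have "finite (UNIV :: nat set)"
    using finite_fun_UNIVD1[where 'a=nat and 'b=bool] by simp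
  then show False by simp
qed

text \<open>
  The coordinates of a homeomorphism onto \<open>{0,1}\<^sup>\<nat>\<close>: agreement in the first \<open>n\<close> coordinates defines
  a neighbourhood base of each point.
\<close>

lemma cantor_space_coordinates:
  assumes "cantor_space TYPE('a::topological_space)"
  obtains h :: "'a::topological_space \<Rightarrow> nat \<Rightarrow> bool" where
    "\<And>n b. open {x. h x n = b}"
    "\<And>U x. open U \<Longrightarrow> x \<in> U \<Longrightarrow> \<exists>n. {y. \<forall>i<n. h y i = h x i} \<subseteq> U"
proof -
  define Y where "Y = product_topology (\<lambda>_::nat. discrete_topology (UNIV :: bool set)) UNIV"
  obtain h :: "'a \<Rightarrow> nat \<Rightarrow> bool" and g where hg: "homeomorphic_maps euclidean Y h g"
    using assms unfolding cantor_space_def homeomorphic_space_def Y_def by blast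
  have ch: "continuous_map euclidean Y h" and cg: "continuous_map Y euclidean g"
    and gh: "g (h x) = x" for x
    using hg by (auto simp: homeomorphic_maps_def)
  have topY: "topspace Y = UNIV"
    by (simp add: Y_def PiE_UNIV_domain)
  show ?thesis
  proof
    fix n b
    have "continuous_map euclidean (discrete_topology UNIV) (\<lambda>x. h x n)"
      using ch unfolding Y_def by (simp add: continuous_map_componentwise_UNIV)
    then have "openin euclidean {x \<in> topspace euclidean. h x n \<in> {b}}"
      by (rule openin_continuous_map_preimage) simp
    then show "open {x. h x n = b}"
      by simp
  next
    fix U and x :: 'a
    assume U: "open U" "x \<in> U"
    have "openin Y {z \<in> topspace Y. g z \<in> U}"
      using openin_continuous_map_preimage[OF cg] U(1) by simp
    moreover have "h x \<in> {z \<in> topspace Y. g z \<in> U}"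
      using U(2) gh topY by simp
    ultimately have "\<exists>W. finite {i \<in> UNIV. W i \<noteq> (UNIV :: bool set)} \<and> h x \<in> Pi\<^sub>E UNIV W
        \<and> Pi\<^sub>E UNIV W \<subseteq> {z \<in> topspace Y. g z \<in> U}"
      unfolding Y_def openin_product_topology_alt topspace_discrete_topology by blast
    then obtain W where fin: "finite {i \<in> UNIV. W i \<noteq> (UNIV :: bool set)}"
      and W: "h x \<in> Pi\<^sub>E UNIV W" "Pi\<^sub>E UNIV W \<subseteq> {z \<in> topspace Y. g z \<in> U}"
      by blast
    obtain n where n: "\<And>i. W i \<noteq> UNIV \<Longrightarrow> i < n"
      using finite_nat_set_iff_bounded fin by auto
    have "y \<in> U" if y: "\<forall>i<n. h y i = h x i" for y
    proof -
      have "h y i \<in> W i" for i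
        using n[of i] y W(1) by (cases "i < n") (auto simp: PiE_UNIV_domain)
      then have "h y \<in> Pi\<^sub>E UNIV W"
        by (simp add: PiE_UNIV_domain)
      then show ?thesis
        using W(2) gh by fastforce
    qed
    then show "\<exists>n. {y. \<forall>i<n. h y i = h x i} \<subseteq> U"
      by blast
  qed
qed

definition clopens :: "'a::topological_space set set" where
  "clopens = {A. open A \<and> closed A}"

text \<open>
  There are only countably many cylinder sets \<open>C bs\<close>, one for each finite list of bits, and the ones
  inside \<open>U\<close> fill \<open>U\<close>.
\<close>

lemma cantor_space_open_countable_Union:
  assumes "cantor_space TYPE('a::topological_space)" and "open (U :: 'a set)"
  obtains \<A> where "countable \<A>" "\<A> \<subseteq> clopens" "U = \<Union> \<A>"
proof -
  obtain h :: "'a \<Rightarrow> nat \<Rightarrow> bool" where ho: "\<And>n b. open {x. h x n = b}"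
    and hU: "\<And>U x. open U \<Longrightarrow> x \<in> U \<Longrightarrow> \<exists>n. {y. \<forall>i<n. h y i = h x i} \<subseteq> U"
    using cantor_space_coordinates[OF assms(1)] by blast
  define C where "C bs = (\<Inter>i<length bs. {y. h y i = bs ! i})" for bs
  have hc: "closed {x. h x n = b}" for n b
  proof -
    have "- {x. h x n = b} = {x. h x n = (\<not> b)}" by auto
    then show ?thesis using ho[of n "\<not> b"] by (simp add: closed_def)
  qed
  have "open (C bs)" for bs
    unfolding C_def by (intro open_INT ballI ho) simp
  moreover have "closed (C bs)" for bs
    unfolding C_def by (intro closed_INT ballI hc)
  ultimately have cl: "C bs \<in> clopens" for bs
    by (simp add: clopens_def)
  define \<A> where "\<A> = C ` {bs. C bs \<subseteq> U}"
  have "\<exists>A\<in>\<A>. x \<in> A" if "x \<in> U" for x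
  proof -
    obtain n where n: "{y. \<forall>i<n. h y i = h x i} \<subseteq> U"
      using hU[OF assms(2) \<open>x \<in> U\<close>] by blast
    have "C (map (h x) [0..<n]) = {y. \<forall>i<n. h y i = h x i}"
      by (auto simp: C_def)
    with n show ?thesis
      unfolding \<A>_def by (intro bexI[of _ "C (map (h x) [0..<n])"]) (auto intro!: imageI)
  qed
  then have "U = \<Union> \<A>"
    by (auto simp: \<A>_def)
  moreover have "countable \<A>"
    by (simp add: \<A>_def)
  moreover have "\<A> \<subseteq> clopens"
    using cl by (auto simp: \<A>_def)
  ultimately show ?thesis
    using that by blast
qed

lemma cantor_space_sets_borel:
  assumes "cantor_space TYPE('a::topological_space)"
  shows "sets (borel :: 'a measure) = sigma_sets UNIV clopens"
proof
  have "sigma_sets UNIV {U :: 'a set. open U} \<subseteq> sigma_sets UNIV clopens"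
  proof (rule sigma_sets_mono, safe)
    fix U :: "'a set"
    assume "open U"
    then obtain \<A> where "countable \<A>" "\<A> \<subseteq> clopens" "U = \<Union> \<A>"
      using cantor_space_open_countable_Union[OF assms] by blast
    then show "U \<in> sigma_sets UNIV clopens"
      by (auto intro: sigma_sets_UNION)
  qed
  then show "sets (borel :: 'a measure) \<subseteq> sigma_sets UNIV clopens"
    by (simp add: borel_def)
  show "sigma_sets UNIV clopens \<subseteq> sets (borel :: 'a measure)"
  proof -
    have "clopens \<subseteq> sets (borel :: 'a measure)"
      by (auto simp: clopens_def)
    from sets.sigma_sets_subset[OF this] show ?thesis
      by simp
  qed
qed

section \<open>Invariant measures from long orbit segments\<close>

definition visit_frequency :: "('a \<Rightarrow> 'a) \<Rightarrow> nat \<Rightarrow> 'a \<Rightarrow> 'a set \<Rightarrow> real" where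
  "visit_frequency S n x A = (\<Sum>i<n. indicator A ((S ^^ i) x)) / real n"

lemma visit_frequency_bounds: "0 \<le> visit_frequency S n x A" "visit_frequency S n x A \<le> 1"
proof -
  show "0 \<le> visit_frequency S n x A"
    unfolding visit_frequency_def by (intro divide_nonneg_nonneg sum_nonneg) auto
  have "(\<Sum>i<n. indicator A ((S ^^ i) x) :: real) \<le> (\<Sum>i<n. 1)"
    by (intro sum_mono) (simp add: indicator_le_1)
  then show "visit_frequency S n x A \<le> 1"
    unfolding visit_frequency_def by (cases "n = 0") (auto simp: divide_le_eq)
qed

lemma visit_frequency_UNIV: "n > 0 \<Longrightarrow> visit_frequency S n x UNIV = 1"
  by (simp add: visit_frequency_def)

lemma visit_frequency_Un:
  assumes "A \<inter> B = {}"
  shows "visit_frequency S n x (A \<union> B) = visit_frequency S n x A + visit_frequency S n x B"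
proof -
  have "indicator (A \<union> B) y = (indicator A y + indicator B y :: real)" for y
    using assms by (auto simp: indicator_def)
  then show ?thesis
    by (simp add: visit_frequency_def sum.distrib add_divide_distrib)
qed

text \<open>
  Passing from \<open>A\<close> to \<open>S\<^sup>-\<^sup>1A\<close> shifts the orbit segment by one step, which changes at most its two
  endpoints. This is why limits of visit frequencies along ever longer segments are invariant.
\<close>

lemma visit_frequency_vimage:
  "\<bar>visit_frequency S n x (S -` A) - visit_frequency S n x A\<bar> \<le> 1 / real n"
proof -
  let ?a = "\<lambda>i. indicator A ((S ^^ i) x) :: real"
  have "(\<Sum>i<n. indicator (S -` A) ((S ^^ i) x)) = (\<Sum>i<n. ?a (Suc i))"
    by (simp add: indicator_def)
  also have "\<dots> = (\<Sum>i<n. ?a i) + ?a n - ?a 0"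
    using sum.lessThan_Suc_shift[of ?a n] by simp
  finally have "visit_frequency S n x (S -` A) - visit_frequency S n x A = (?a n - ?a 0) / real n"
    by (simp add: visit_frequency_def flip: diff_divide_distrib)
  moreover have "\<bar>?a n - ?a 0\<bar> \<le> 1"
    by (auto simp: indicator_def)
  ultimately show ?thesis
    by (simp add: abs_divide divide_right_mono)
qed

lemma sum_eq_visit_frequency:
  assumes "\<And>y. f y \<le> (P :: nat)"
  shows "(\<Sum>i<n. real (f ((S ^^ i) x))) / real n
    = (\<Sum>k\<le>P. real k * visit_frequency S n x {y. f y = k})"
proof -
  have "real (f y) = (\<Sum>k\<le>P. real k * indicator {y. f y = k} y)" for y
    using assms[of y] by (simp add: indicator_def if_distrib sum.delta cong: if_cong)
  then have "(\<Sum>i<n. real (f ((S ^^ i) x)))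
    = (\<Sum>i<n. \<Sum>k\<le>P. real k * indicator {y. f y = k} ((S ^^ i) x))"
    by simp
  also have "\<dots> = (\<Sum>k\<le>P. \<Sum>i<n. real k * indicator {y. f y = k} ((S ^^ i) x))"
    by (rule sum.swap)
  also have "\<dots> = (\<Sum>k\<le>P. real k * (\<Sum>i<n. indicator {y. f y = k} ((S ^^ i) x)))"
    by (simp only: sum_distrib_left)
  finally show ?thesis
    by (simp only: visit_frequency_def times_divide_eq_right flip: sum_divide_distrib)
qed

lemma compact_unit_cube: "compact {f :: 'i \<Rightarrow> real. \<forall>i. f i \<in> {0..1}}"
proof -
  have "compactin (product_topology (\<lambda>_. euclidean) UNIV) (Pi\<^sub>E (UNIV :: 'i set) (\<lambda>_. {0..1::real}))"
    by (subst compactin_PiE) auto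
  moreover have "Pi\<^sub>E (UNIV :: 'i set) (\<lambda>_. {0..1::real}) = {f. \<forall>i. f i \<in> {0..1}}"
    by (auto simp: PiE_UNIV_domain)
  ultimately show ?thesis
    by (simp add: euclidean_product_topology)
qed

text \<open>
  The set functions \<open>visit_frequency S (N k) (x k)\<close> lie in the compact cube of all functions from sets
  to the unit interval, so they have a cluster point \<open>m\<close> there. Every linear relation that the
  frequencies satisfy, exactly or in the limit, passes to \<open>m\<close>. In particular \<open>m\<close> is finitely additive and
  invariant on all subsets; countable additivity is recovered from the clopen sets afterwards.
\<close>

lemma exists_limit_frequency:
  fixes N :: "nat \<Rightarrow> nat" and x :: "nat \<Rightarrow> 'a"
  assumes N: "filterlim N at_top sequentially"
    and bound: "\<And>y. f y \<le> (P :: nat)"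
    and avg: "\<And>k. a \<le> (\<Sum>i<N k. real (f ((S ^^ i) (x k)))) / real (N k)"
  obtains m :: "'a set \<Rightarrow> real" where
    "\<And>A. 0 \<le> m A" "m UNIV = 1"
    "\<And>A B. A \<inter> B = {} \<Longrightarrow> m (A \<union> B) = m A + m B"
    "\<And>A. m (S -` A) = m A"
    "a \<le> (\<Sum>k\<le>P. real k * m {y. f y = k})"
proof -
  define E where "E k = visit_frequency S (N k) (x k)" for k
  define F where "F = filtermap E sequentially"
  have "F \<noteq> bot"
    by (simp add: F_def filtermap_bot_iff)
  moreover have "eventually (\<lambda>e. e \<in> {f. \<forall>i. f i \<in> {0..1}}) F"
    by (simp add: F_def eventually_filtermap E_def visit_frequency_bounds)
  ultimately obtain m where m: "inf (nhds m) F \<noteq> bot"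
    using compact_unit_cube[unfolded compact_filter] by blast
  \<comment> \<open>Along the filter \<open>G\<close> the frequencies converge to \<open>m\<close> at every set, while every property
    that eventually holds for them still holds; it takes the place of a convergent subsequence.\<close>
  define G where "G = inf (nhds m) F"
  have G: "G \<noteq> bot" "G \<le> nhds m" "G \<le> F"
    using m by (auto simp: G_def)
  have lim: "((\<lambda>e. e A) \<longlongrightarrow> m A) G" for A
  proof -
    have "((\<lambda>e. e A) \<longlongrightarrow> m A) (nhds m)"
    proof (rule topological_tendstoI)
      fix U :: "real set"
      assume U: "open U" "m A \<in> U"
      have "open ((\<lambda>e. e A) -` U)"
        using U(1) by (intro open_vimage continuous_on_product_coordinates)
      then show "eventually (\<lambda>e. e A \<in> U) (nhds m)"
        using U(2) by (auto simp: eventually_nhds)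
    qed
    then show ?thesis
      using G(2) by (rule tendsto_mono[rotated])
  qed
  have ev: "eventually Q G" if "eventually (\<lambda>k. Q (E k)) sequentially" for Q
    using that G(3) by (auto simp: F_def eventually_filtermap intro: filter_leD)
  have Npos: "eventually (\<lambda>k. N k > n) sequentially" for n
    by (rule eventually_compose_filterlim[OF eventually_gt_at_top N])
  show ?thesis
  proof
    show "0 \<le> m A" for A
      by (rule tendsto_lowerbound[OF lim _ G(1)])
        (auto intro!: ev simp: E_def visit_frequency_bounds)
    have "eventually (\<lambda>e. e UNIV = 1) G"
      by (intro ev eventually_mono[OF Npos[of 0]]) (simp add: E_def visit_frequency_UNIV)
    then have "((\<lambda>e. e UNIV) \<longlongrightarrow> 1) G"
      by (rule tendsto_eventually)
    then show "m UNIV = 1"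
      using tendsto_unique[OF G(1) lim] by blast
    show "m (A \<union> B) = m A + m B" if "A \<inter> B = {}" for A B
    proof -
      have "eventually (\<lambda>e. e (A \<union> B) = e A + e B) G"
        using that by (intro ev always_eventually allI) (simp add: E_def visit_frequency_Un)
      then have "((\<lambda>e. e A + e B) \<longlongrightarrow> m (A \<union> B)) G"
        by (rule Lim_transform_eventually[OF lim])
      then show ?thesis
        using tendsto_unique[OF G(1) _ tendsto_add[OF lim lim]] by blast
    qed
    show "m (S -` A) = m A" for A
    proof -
      have "\<bar>m (S -` A) - m A\<bar> \<le> \<epsilon>" if "\<epsilon> > 0" for \<epsilon>
      proof -
        obtain n :: nat where n: "n > 0" "1 / real n < \<epsilon>"
          using real_arch_inverse[of \<epsilon>] \<open>\<epsilon> > 0\<close> by (auto simp: inverse_eq_divide)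
        have "eventually (\<lambda>k. \<bar>E k (S -` A) - E k A\<bar> \<le> \<epsilon>) sequentially"
        proof (rule eventually_mono[OF Npos[of n]])
          fix k assume "N k > n"
          then have "1 / real (N k) \<le> 1 / real n"
            using n(1) by (intro divide_left_mono) auto
          then show "\<bar>E k (S -` A) - E k A\<bar> \<le> \<epsilon>"
            using visit_frequency_vimage[of S "N k" "x k" A] n(2) by (simp add: E_def)
        qed
        then have "eventually (\<lambda>e. \<bar>e (S -` A) - e A\<bar> \<le> \<epsilon>) G"
          by (rule ev)
        then show ?thesis
          by (intro tendsto_upperbound[OF tendsto_rabs[OF tendsto_diff[OF lim lim]] _ G(1)])
      qed
      then have "\<bar>m (S -` A) - m A\<bar> \<le> 0"
        by (rule field_le_epsilon) simp
      then show ?thesis by simp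
    qed
    have "a \<le> (\<Sum>k\<le>P. real k * E l {y. f y = k})" for l
      using avg[of l] unfolding sum_eq_visit_frequency[of f, OF bound] E_def .
    then have "eventually (\<lambda>e. a \<le> (\<Sum>k\<le>P. real k * e {y. f y = k})) G"
      by (intro ev always_eventually allI)
    then show "a \<le> (\<Sum>k\<le>P. real k * m {y. f y = k})"
      by (intro tendsto_lowerbound[OF tendsto_sum[OF tendsto_mult_left[OF lim]] _ G(1)])
  qed
qed

text \<open>
  On the clopen sets finite additivity is enough for Caratheodory's extension theorem: by compactness, a
  decreasing sequence of clopen sets with empty intersection is eventually empty.
\<close>

lemma content_extends_to_borel:
  fixes m :: "'a::topological_space set \<Rightarrow> real"
  assumes cantor: "cantor_space TYPE('a)"
    and nonneg: "\<And>A. 0 \<le> m A"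
    and additive: "\<And>A B. A \<inter> B = {} \<Longrightarrow> m (A \<union> B) = m A + m B"
  obtains \<mu> :: "'a::topological_space measure" where "sets \<mu> = sets borel"
    "\<And>A. A \<in> clopens \<Longrightarrow> emeasure \<mu> A = ennreal (m A)"
proof -
  have alg: "algebra UNIV (clopens :: 'a set set)"
    unfolding algebra_iff_Un by (auto simp: clopens_def)
  interpret algebra UNIV "clopens :: 'a set set" by fact
  have m0: "m {} = 0"
    using additive[of "{}" "{}"] by simp
  have "\<exists>\<mu>. (\<forall>s\<in>clopens. \<mu> s = ennreal (m s)) \<and> measure_space UNIV (sigma_sets UNIV clopens) \<mu>"
  proof (rule caratheodory_empty_continuous)
    show "positive clopens (\<lambda>A. ennreal (m A))"
      by (simp add: positive_def m0)
    show "Measure_Space.additive clopens (\<lambda>A. ennreal (m A))"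
      by (simp add: Measure_Space.additive_def additive ennreal_plus nonneg)
    show "ennreal (m A) \<noteq> \<infinity>" for A by simp
    fix A :: "nat \<Rightarrow> 'a set"
    assume A: "range A \<subseteq> clopens" "decseq A" "(\<Inter>i. A i) = {}"
    have "\<exists>n. A n = {}"
    proof (rule ccontr)
      assume ne: "\<nexists>n. A n = {}"
      have cl: "closed (A i)" for i
        using A(1) by (auto simp: clopens_def)
      have "UNIV \<inter> (\<Inter>i\<in>UNIV. A i) \<noteq> {}"
      proof (rule compact_imp_fip_image[OF cantor_space_compact[OF cantor]])
        show "closed (A i)" for i by (rule cl)
        fix I :: "nat set" assume I: "finite I" "I \<subseteq> UNIV"
        then obtain n where "\<forall>i\<in>I. i \<le> n"
          using finite_nat_set_iff_bounded_le by blast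
        then have "A n \<subseteq> (\<Inter>i\<in>I. A i)"
          using A(2) by (auto simp: decseq_def)
        then show "UNIV \<inter> (\<Inter>i\<in>I. A i) \<noteq> {}"
          using ne by auto
      qed
      then show False using A(3) by simp
    qed
    then obtain n where n: "A n = {}" by blast
    have "A k = {}" if "k \<ge> n" for k
      using A(2) n that by (force simp: decseq_def)
    then show "(\<lambda>i. ennreal (m (A i))) \<longlonglongrightarrow> 0"
      by (intro tendsto_eventually eventually_sequentiallyI[of n]) (simp add: m0)
  qed
  then obtain \<nu> where \<nu>: "\<And>A. A \<in> clopens \<Longrightarrow> \<nu> A = ennreal (m A)"
    "measure_space UNIV (sigma_sets UNIV clopens) \<nu>"
    by blast
  define \<mu> where "\<mu> = measure_of UNIV (sigma_sets UNIV clopens) \<nu>"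
  have "sets \<mu> = sets borel"
    by (simp add: \<mu>_def cantor_space_sets_borel[OF cantor] sigma_sets_sigma_sets_eq)
  moreover have "emeasure \<mu> A = ennreal (m A)" if "A \<in> clopens" for A
    using \<nu> that unfolding \<mu>_def measure_space_def
    by (subst emeasure_measure_of_sigma) auto
  ultimately show ?thesis
    using that by blast
qed

proposition invariant_measure_with_large_integral:
  fixes S :: "'a::topological_space \<Rightarrow> 'a" and f :: "'a \<Rightarrow> nat"
  assumes cantor: "cantor_space TYPE('a)"
    and S: "continuous_on UNIV S"
    and f: "\<And>k. {y. f y = k} \<in> clopens" and bound: "\<And>y. f y \<le> P"
    and large: "\<And>N. \<exists>n\<ge>N. \<exists>x. a * real n \<le> (\<Sum>i<n. real (f ((S ^^ i) x)))"
  shows "\<exists>\<mu>\<in>invariant_measures S. a \<le> (\<integral>x. real (f x) \<partial>\<mu>)"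
proof -
  obtain N x where Nx: "\<And>k. N k \<ge> Suc k"
    "\<And>k. a * real (N k) \<le> (\<Sum>i<N k. real (f ((S ^^ i) (x k))))"
    using large[of "Suc _"] by metis
  have N: "filterlim N at_top sequentially"
    using Nx(1) by (intro filterlim_at_top_mono[OF filterlim_Suc]) auto
  have avg: "a \<le> (\<Sum>i<N k. real (f ((S ^^ i) (x k)))) / real (N k)" for k
    using Nx[of k] by (simp add: le_divide_eq)
  obtain m where m: "\<And>A. 0 \<le> m A" "m UNIV = 1"
    "\<And>A B. A \<inter> B = {} \<Longrightarrow> m (A \<union> B) = m A + m B"
    "\<And>A. m (S -` A) = m A"
    "a \<le> (\<Sum>k\<le>P. real k * m {y. f y = k})"
    using exists_limit_frequency[where N=N and x=x and f=f and P=P and S=S and a=a, OF N bound avg]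
    by blast
  obtain \<mu> :: "'a measure" where \<mu>: "sets \<mu> = sets borel"
    "\<And>A. A \<in> clopens \<Longrightarrow> emeasure \<mu> A = ennreal (m A)"
    using content_extends_to_borel[OF cantor m(1,3)] by blast
  have space: "space \<mu> = UNIV"
    using sets_eq_imp_space_eq[OF \<mu>(1)] by simp
  have prob: "prob_space \<mu>"
    by standard (simp add: space \<mu>(2) m(2) clopens_def)
  interpret prob_space \<mu> by fact
  have Sm: "S \<in> measurable \<mu> borel"
    using borel_measurable_continuous_onI[OF S] \<mu>(1) by (simp cong: measurable_cong_sets)
  have Scl: "S -` A \<in> clopens" if "A \<in> clopens" for A
    using that S by (auto simp: clopens_def intro: open_vimage closed_vimage)
  have "distr \<mu> borel S = \<mu>"
  proof (rule measure_eqI_generator_eq[where E=clopens and \<Omega>=UNIV and A="\<lambda>_. UNIV"])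
    show "Int_stable clopens"
      by (auto simp: Int_stable_def clopens_def)
    show "emeasure (distr \<mu> borel S) A = emeasure \<mu> A" if "A \<in> clopens" for A
    proof -
      have "A \<in> sets borel"
        using that cantor_space_sets_borel[OF cantor] by auto
      then show ?thesis
        using Sm that by (simp add: emeasure_distr space \<mu>(2) Scl m(4))
    qed
    show "sets (distr \<mu> borel S) = sigma_sets UNIV clopens" "sets \<mu> = sigma_sets UNIV clopens"
      using \<mu>(1) cantor_space_sets_borel[OF cantor] by auto
    show "emeasure (distr \<mu> borel S) UNIV \<noteq> \<infinity>"
      using emeasure_distr[OF Sm, of UNIV] by (simp add: space)
  qed (auto simp: clopens_def)
  then have inv: "\<mu> \<in> invariant_measures S"
    using prob \<mu>(1) by (simp add: invariant_measures_def)
  have lev: "{y. f y = k} \<in> sets \<mu>" for k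
    using f[of k] cantor_space_sets_borel[OF cantor] \<mu>(1) by auto
  have meas: "measure \<mu> {y. f y = k} = m {y. f y = k}" for k
    using \<mu>(2)[OF f[of k]] m(1) by (simp add: measure_def)
  have "real (f y) = (\<Sum>k\<le>P. real k * indicator {y. f y = k} y)" for y
    using bound[of y] by (simp add: indicator_def if_distrib sum.delta cong: if_cong)
  then have "(\<integral>x. real (f x) \<partial>\<mu>) = (\<integral>x. (\<Sum>k\<le>P. real k * indicator {y. f y = k} x) \<partial>\<mu>)"
    by simp
  also have "\<dots> = (\<Sum>k\<le>P. \<integral>x. real k * indicator {y. f y = k} x \<partial>\<mu>)"
    using lev by (intro Bochner_Integration.integral_sum integrable_mult_right
        integrable_real_indicator) (auto simp: less_top[symmetric])
  also have "\<dots> = (\<Sum>k\<le>P. real k * m {y. f y = k})"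
    using lev by (simp add: space meas)
  finally have "(\<integral>x. real (f x) \<partial>\<mu>) = (\<Sum>k\<le>P. real k * m {y. f y = k})" .
  then show ?thesis
    using inv m(5) by (intro bexI[of _ \<mu>]) simp_all
qed

section \<open>Counting with open covers\<close>

lemma min_subcover_card_attained:
  assumes "compact (UNIV :: 'a::topological_space set)" "open_cover (\<A> :: 'a set set)"
  obtains \<V> where "\<V> \<subseteq> \<A>" "finite \<V>" "card \<V> = min_subcover_card \<A>" "\<Union> \<V> = UNIV"
proof -
  obtain \<V> where "\<V> \<subseteq> \<A>" "finite \<V>" "UNIV \<subseteq> \<Union> \<V>"
    using compactE[OF assms(1), of \<A>] assms(2) by (auto simp: open_cover_def)
  then have "\<exists>n. \<exists>\<V>\<subseteq>\<A>. finite \<V> \<and> card \<V> = n \<and> \<Union> \<V> = UNIV"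
    by blast
  from LeastI_ex[OF this] show ?thesis
    using that unfolding min_subcover_card_def by blast
qed

text \<open>
  The sets \<open>W i\<close> may fail to be open or to belong to \<open>\<A>\<close>: any finite family that covers the space and
  refines \<open>\<A>\<close> bounds the size of a minimal subcover. Empty \<open>W i\<close> are exempt because the member of a
  join that contains \<open>W i\<close> will be read off from a point of \<open>W i\<close>.
\<close>

lemma min_subcover_card_le:
  assumes I: "finite I" and W: "(\<Union>i\<in>I. W i) = UNIV"
    and refine: "\<And>i. i \<in> I \<Longrightarrow> W i \<noteq> {} \<Longrightarrow> \<exists>A\<in>\<A>. W i \<subseteq> A"
  shows "min_subcover_card \<A> \<le> card I"
proof -
  define J where "J = {i \<in> I. W i \<noteq> {}}"
  obtain A where A: "\<And>i. i \<in> J \<Longrightarrow> A i \<in> \<A> \<and> W i \<subseteq> A i"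
    using refine unfolding J_def by (metis (mono_tags, lifting) mem_Collect_eq)
  have J: "finite J" "card J \<le> card I"
    using I by (auto simp: J_def intro: card_mono)
  have "\<Union> (A ` J) = UNIV"
  proof -
    have "x \<in> \<Union> (A ` J)" for x
    proof -
      obtain i where "i \<in> I" "x \<in> W i"
        using W by blast
      then have "i \<in> J" "x \<in> A i"
        using A[of i] by (auto simp: J_def)
      then show ?thesis by blast
    qed
    then show ?thesis by blast
  qed
  then have "\<exists>\<V>\<subseteq>\<A>. finite \<V> \<and> card \<V> = card (A ` J) \<and> \<Union> \<V> = UNIV"
    using A J(1) by (intro exI[of _ "A ` J"]) auto
  then have "min_subcover_card \<A> \<le> card (A ` J)"
    unfolding min_subcover_card_def by (rule Least_le)
  also have "\<dots> \<le> card I"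
    using card_image_le[OF J(1), of A] J(2) by linarith
  finally show ?thesis .
qed

lemma continuous_on_funpow:
  fixes T :: "'a::topological_space \<Rightarrow> 'a"
  assumes "continuous_on UNIV T"
  shows "continuous_on UNIV (T ^^ n)"
proof (induction n)
  case 0
  then show ?case by (simp add: id_def)
next
  case (Suc n)
  then show ?case
    using assms by (auto intro: continuous_on_compose[unfolded o_def] continuous_on_subset simp: o_def)
qed

lemma open_cover_cover_join:
  fixes T :: "'a::topological_space \<Rightarrow> 'a"
  assumes T: "continuous_on UNIV T" and \<U>: "open_cover \<U>"
  shows "open_cover (cover_join T \<U> n)"
  unfolding open_cover_def
proof
  show "\<forall>A\<in>cover_join T \<U> n. open A"
  proof
    fix A assume "A \<in> cover_join T \<U> n"
    then obtain U where U: "\<forall>i<n. U i \<in> \<U>" "A = (\<Inter>i<n. (T ^^ i) -` U i)"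
      by (auto simp: cover_join_def)
    have "open ((T ^^ i) -` U i)" if "i < n" for i
      using U(1) \<U> that by (intro open_vimage continuous_on_funpow[OF T]) (auto simp: open_cover_def)
    then show "open A"
      unfolding U(2) by (intro open_INT) auto
  qed
  show "\<Union> (cover_join T \<U> n) = UNIV"
  proof -
    have "\<exists>A\<in>cover_join T \<U> n. x \<in> A" for x
    proof -
      have "\<forall>i. \<exists>U\<in>\<U>. (T ^^ i) x \<in> U"
        using \<U> by (auto simp: open_cover_def)
      then obtain U where U: "\<And>i. U i \<in> \<U> \<and> (T ^^ i) x \<in> U i"
        by metis
      then have "(\<Inter>i<n. (T ^^ i) -` U i) \<in> cover_join T \<U> n"
        unfolding cover_join_def by blast
      moreover have "x \<in> (\<Inter>i<n. (T ^^ i) -` U i)"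
        using U by simp
      ultimately show ?thesis by blast
    qed
    then show ?thesis by blast
  qed
qed

text \<open>
  If \<open>N n \<le> C M(\<phi> n)\<close> and \<open>\<phi> n\<close> grows like \<open>\<kappa> n\<close>, then the exponential growth rate of \<open>N\<close> is at most
  \<open>\<kappa>\<close> times that of \<open>M\<close>: any \<open>a\<close> above the rate of \<open>M\<close> gives
  \<open>ln N(n) / n \<le> ln C / n + a \<phi>(n) / n\<close>, which tends to \<open>a \<kappa>\<close>. Both entropy inequalities are
  instances of this comparison.
\<close>

lemma limsup_growth_rate_compare:
  fixes N M \<phi> :: "nat \<Rightarrow> nat" and \<kappa> :: real and C :: nat
  assumes \<kappa>: "\<kappa> > 0" and \<phi>: "(\<lambda>n. real (\<phi> n) / real n) \<longlonglongrightarrow> \<kappa>"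
    and le: "eventually (\<lambda>n. N n \<le> C * M (\<phi> n)) sequentially"
  shows "limsup (\<lambda>n. ereal (ln (real (N n)) / real n))
    \<le> ereal \<kappa> * limsup (\<lambda>n. ereal (ln (real (M n)) / real n))"
proof -
  let ?L = "limsup (\<lambda>n. ereal (ln (real (M n)) / real n))"
  let ?K = "limsup (\<lambda>n. ereal (ln (real (N n)) / real n))"
  have ln_nonneg: "0 \<le> ln (real k)" for k :: nat
    by (cases "k = 0") auto
  have L0: "0 \<le> ?L"
    by (rule le_Limsup) (auto simp: ln_nonneg intro!: always_eventually)
  have \<phi>_at_top: "filterlim \<phi> at_top sequentially"
  proof -
    have "filterlim (\<lambda>n. (real (\<phi> n) / real n) * real n) at_top sequentially"
      by (rule filterlim_tendsto_pos_mult_at_top[OF \<phi> \<kappa> filterlim_real_sequentially])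
    moreover have "eventually (\<lambda>n. (real (\<phi> n) / real n) * real n = real (\<phi> n)) sequentially"
      using eventually_gt_at_top[of 0] by eventually_elim simp
    ultimately have "filterlim (\<lambda>n. real (\<phi> n)) at_top sequentially"
      by (simp cong: filterlim_cong)
    then show ?thesis
      by (simp add: filterlim_sequentially_iff_filterlim_real)
  qed
  have bound: "?K \<le> ereal (a * \<kappa>)" if a: "?L < ereal a" for a :: real
  proof -
    have "eventually (\<lambda>n. ereal (ln (real (M n)) / real n) < ereal a) sequentially"
      by (rule Limsup_lessD[OF a])
    then have "eventually (\<lambda>n. ln (real (M n)) / real n < a \<and> n > 0) sequentially"
      using eventually_gt_at_top[of 0] by eventually_elim simp
    then have "eventually (\<lambda>n. ln (real (M n)) \<le> a * real n) sequentially"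
      by eventually_elim (simp add: divide_less_eq less_imp_le)
    then have M: "eventually (\<lambda>n. ln (real (M (\<phi> n))) \<le> a * real (\<phi> n)) sequentially"
      using \<phi>_at_top by (rule eventually_compose_filterlim)
    have a0: "0 \<le> a"
      using le_less_trans[OF L0 a] by simp
    have "eventually (\<lambda>n. ln (real (N n)) / real n
        \<le> ln (real C) / real n + a * (real (\<phi> n) / real n)) sequentially"
      using M le eventually_gt_at_top[of 0]
    proof eventually_elim
      case (elim n)
      have "ln (real (N n)) \<le> ln (real C) + a * real (\<phi> n)"
      proof (cases "N n = 0")
        case True
        then show ?thesis
          using a0 ln_nonneg[of C] by simp
      next
        case False
        then have "0 < C" "0 < M (\<phi> n)"
          using elim(2) by (auto intro!: Nat.gr0I)
        have "ln (real (N n)) \<le> ln (real C * real (M (\<phi> n)))"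
          using elim(2) False by (subst ln_le_cancel_iff)
            (auto simp: \<open>0 < C\<close> \<open>0 < M (\<phi> n)\<close> simp flip: of_nat_mult)
        also have "\<dots> = ln (real C) + ln (real (M (\<phi> n)))"
          using \<open>0 < C\<close> \<open>0 < M (\<phi> n)\<close> by (simp add: ln_mult)
        finally show ?thesis
          using elim(1) by simp
      qed
      then have "ln (real (N n)) / real n \<le> (ln (real C) + a * real (\<phi> n)) / real n"
        by (rule divide_right_mono) simp
      then show ?case
        by (simp add: add_divide_distrib)
    qed
    then have "?K \<le> limsup (\<lambda>n. ereal (ln (real C) / real n + a * (real (\<phi> n) / real n)))"
      by (intro Limsup_mono) (simp add: eventually_mono)
    also have "\<dots> = ereal (a * \<kappa>)"
    proof (rule lim_imp_Limsup)
      have "(\<lambda>n. ln (real C) / real n + a * (real (\<phi> n) / real n)) \<longlonglongrightarrow> 0 + a * \<kappa>"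
        by (intro tendsto_add tendsto_mult_left \<phi> lim_const_over_n)
      then show "(\<lambda>n. ereal (ln (real C) / real n + a * (real (\<phi> n) / real n))) \<longlonglongrightarrow> ereal (a * \<kappa>)"
        by simp
    qed simp
    finally show ?thesis .
  qed
  show ?thesis
  proof (cases ?L)
    case (real l)
    have "?K \<le> ereal \<kappa> * ?L + ereal e" if "e > 0" for e
    proof -
      have "?K \<le> ereal ((l + e / \<kappa>) * \<kappa>)"
        using that \<kappa> by (intro bound) (simp add: real)
      also have "\<dots> = ereal \<kappa> * ?L + ereal e"
        using \<kappa> by (simp add: real field_simps)
      finally show ?thesis .
    qed
    then show ?thesis
      by (rule ereal_le_epsilon2)
  next
    case PInf
    then show ?thesis using \<kappa> by simp
  next
    case MInf
    then show ?thesis using L0 by simp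
  qed
qed

proposition cover_entropy_le:
  assumes "\<kappa> > 0" and "(\<lambda>n. real (\<phi> n) / real n) \<longlonglongrightarrow> \<kappa>"
    and "eventually (\<lambda>n. min_subcover_card (cover_join T \<U> n)
      \<le> C * min_subcover_card (cover_join S \<V> (\<phi> n))) sequentially"
  shows "cover_entropy T \<U> \<le> ereal \<kappa> * cover_entropy S \<V>"
  unfolding cover_entropy_def using assms by (rule limsup_growth_rate_compare)

lemma cover_entropy_nonneg: "0 \<le> cover_entropy T \<U>"
  unfolding cover_entropy_def
proof (rule le_Limsup)
  have "0 \<le> ln (real k)" for k :: nat
    by (cases "k = 0") auto
  then show "\<forall>\<^sub>F n in sequentially. 0 \<le> ereal (ln (real (min_subcover_card (cover_join T \<U> n))) / real n)"
    by (intro always_eventually) simp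
qed simp

lemma topological_entropy_nonneg: "0 \<le> topological_entropy (T :: 'a::topological_space \<Rightarrow> 'a)"
  unfolding topological_entropy_def
  by (rule SUP_upper2[of "{UNIV}"]) (simp_all add: open_cover_def cover_entropy_nonneg)

section \<open>Integer iterates and orbits\<close>

definition zpow :: "('a \<Rightarrow> 'a) \<Rightarrow> int \<Rightarrow> 'a \<Rightarrow> 'a" where
  "zpow f k = (if 0 \<le> k then f ^^ nat k else inv f ^^ nat (- k))"

lemma zpow_0 [simp]: "zpow f 0 x = x"
  by (simp add: zpow_def)

lemma zpow_of_nat: "zpow f (int n) x = (f ^^ n) x"
  by (simp add: zpow_def)

lemma zpow_succ:
  assumes "bij f"
  shows "zpow f (k + 1) x = f (zpow f k x)"
proof (cases "0 \<le> k")
  case True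
  then show ?thesis
    by (simp add: zpow_def nat_add_distrib)
next
  case False
  then have "nat (- k) = Suc (nat (- (k + 1)))"
    by simp
  then have "f (zpow f k x) = (inv f ^^ nat (- (k + 1))) x"
    using False assms by (simp add: zpow_def bij_is_surj surj_f_inv_f)
  also have "\<dots> = zpow f (k + 1) x"
    using False by (cases "k = - 1") (auto simp: zpow_def)
  finally show ?thesis by simp
qed

lemma zpow_add:
  assumes "bij f"
  shows "zpow f (a + b) x = zpow f a (zpow f b x)"
proof (induction a rule: int_induct[where k=0])
  case base
  then show ?case by simp
next
  case (step1 i)
  then show ?case
    using zpow_succ[OF assms, of "i + b"] zpow_succ[OF assms, of i] by (simp add: algebra_simps)
next
  case (step2 i)
  have "f (zpow f (i - 1 + b) x) = f (zpow f (i - 1) (zpow f b x))"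
    using step2 zpow_succ[OF assms, of "i - 1 + b"] zpow_succ[OF assms, of "i - 1"]
    by (simp add: algebra_simps)
  then show ?case
    using assms by (simp add: bij_is_inj inj_eq)
qed

lemma full_orbit_eq_range_zpow: "full_orbit f x = range (\<lambda>k. zpow f k x)"
proof
  have "(f ^^ n) x = zpow f (int n) x" "(inv f ^^ n) x = zpow f (- int n) x" for n
    by (cases "n = 0"; simp add: zpow_def)+
  then show "full_orbit f x \<subseteq> range (\<lambda>k. zpow f k x)"
    unfolding full_orbit_def by auto
  show "range (\<lambda>k. zpow f k x) \<subseteq> full_orbit f x"
    by (auto simp: full_orbit_def zpow_def)
qed

lemma zpow_in_full_orbit: "zpow f k x \<in> full_orbit f x"
  by (simp add: full_orbit_eq_range_zpow)

lemma self_in_full_orbit: "x \<in> full_orbit f x"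
  using zpow_in_full_orbit[of f 0 x] by simp

lemma full_orbit_eq:
  assumes "bij f" and "y \<in> full_orbit f x"
  shows "full_orbit f y = full_orbit f x"
proof -
  obtain k where y: "y = zpow f k x"
    using assms(2) by (auto simp: full_orbit_eq_range_zpow)
  have "zpow f a y \<in> full_orbit f x" for a
    using zpow_in_full_orbit[of f "a + k" x] zpow_add[OF assms(1), of a k x] by (simp add: y)
  moreover have "zpow f a x \<in> full_orbit f y" for a
    using zpow_in_full_orbit[of f "a - k" y] zpow_add[OF assms(1), of "a - k" k x] by (simp add: y)
  ultimately show ?thesis
    by (metis full_orbit_eq_range_zpow image_subsetI subset_antisym)
qed

lemma homeomorphic_map_euclidean_bij:
  "homeomorphic_map euclidean euclidean f \<Longrightarrow> bij f"
  using homeomorphic_imp_injective_map[of euclidean euclidean f]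
    homeomorphic_imp_surjective_map[of euclidean euclidean f]
  by (simp add: bij_def)

lemma homeomorphic_map_euclidean_continuous:
  "homeomorphic_map euclidean euclidean f \<Longrightarrow> continuous_on UNIV f"
  using homeomorphic_imp_continuous_map[of euclidean euclidean f] by simp

lemma homeomorphic_map_euclidean_continuous_inv:
  assumes "homeomorphic_map euclidean euclidean f"
  shows "continuous_on UNIV (inv f)"
proof -
  obtain g where g: "homeomorphic_maps euclidean euclidean f g"
    using assms homeomorphic_map_maps by blast
  have "inv f = g"
    using g by (intro inv_equality) (auto simp: homeomorphic_maps_def)
  then show ?thesis
    using g by (simp add: homeomorphic_maps_def)
qed

lemma continuous_on_zpow:
  fixes f :: "'a::topological_space \<Rightarrow> 'a"
  assumes "homeomorphic_map euclidean euclidean f"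
  shows "continuous_on UNIV (zpow f k)"
  unfolding zpow_def
  by (simp add: continuous_on_funpow homeomorphic_map_euclidean_continuous[OF assms]
      homeomorphic_map_euclidean_continuous_inv[OF assms])

text \<open>
  A periodic point would have a finite, hence closed, orbit; being dense, that orbit would be the
  whole space, which is infinite. So integer positions along a \<open>T\<close>-orbit are well defined.
\<close>

lemma minimal_cantor_system_aperiodic:
  fixes T :: "'a::topological_space \<Rightarrow> 'a"
  assumes T: "minimal_cantor_system T" and eq: "zpow T a x = zpow T b x"
  shows "a = b"
proof -
  have cantor: "cantor_space TYPE('a)" and bij: "bij T"
    and dense: "closure (full_orbit T x) = UNIV"
    using T homeomorphic_map_euclidean_bij
    by (auto simp: minimal_cantor_system_def all_orbits_dense_def)
  have no_period: False if d: "d > 0" and per: "zpow T d x = x" for d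
  proof -
    have mult: "zpow T (d * q) x = x" for q
    proof (induction q rule: int_induct[where k=0])
      case base
      then show ?case by simp
    next
      case (step1 i)
      then show ?case
        using zpow_add[OF bij, of "d * i" d x] per by (simp add: algebra_simps)
    next
      case (step2 i)
      then show ?case
        using zpow_add[OF bij, of "d * (i - 1)" d x] per by (simp add: algebra_simps)
    qed
    have "zpow T k x = zpow T (k mod d) x" for k
      using zpow_add[OF bij, of "k mod d" "d * (k div d)" x] mult[of "k div d"] by simp
    then have "zpow T k x \<in> (\<lambda>k. zpow T k x) ` {0..<d}" for k
      using d by (intro rev_image_eqI[of "k mod d"]) auto
    then have "full_orbit T x \<subseteq> (\<lambda>k. zpow T k x) ` {0..<d}"
      by (auto simp: full_orbit_eq_range_zpow)
    then have fin: "finite (full_orbit T x)"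
      by (rule finite_subset) simp
    have "t1_space (euclidean :: 'a topology)"
      using cantor_space_Hausdorff[OF cantor] by (rule Hausdorff_imp_t1_space)
    then have "closed (full_orbit T x)"
      using fin by (auto simp: t1_space_closedin_finite)
    then have "full_orbit T x = UNIV"
      using dense by simp
    then show False
      using fin cantor_space_infinite[OF cantor] by simp
  qed
  have "zpow T (d - e) x = x" if "zpow T d x = zpow T e x" for d e
    using zpow_add[OF bij, of "- e" d x] zpow_add[OF bij, of "- e" e x] that by simp
  then have "\<not> a < b" "\<not> b < a"
    using no_period[of "b - a"] no_period[of "a - b"] eq by auto
  then show ?thesis by simp
qed

section \<open>Bounded speedups\<close>

text \<open>
  The number \<open>P\<close> is a bound for \<open>p\<close>. It is fixed here because it occurs as a counting constant: it
  bounds the number of places from which an \<open>S\<close>-step can jump over a given position.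
\<close>

locale bounded_speedup =
  fixes T :: "'a::topological_space \<Rightarrow> 'a" and p :: "'a \<Rightarrow> nat" and P :: nat
  assumes minimal_T: "minimal_cantor_system T"
    and p_pos: "p x > 0" and p_le: "p x \<le> P"
    and homeo_S: "homeomorphic_map euclidean euclidean (speedup T p)"
begin

abbreviation S :: "'a \<Rightarrow> 'a" where
  "S \<equiv> speedup T p"

text \<open>
  The distance in \<open>T\<close>-steps covered by \<open>n\<close> steps of \<open>S\<close>: the cocycle \<open>p\<^sub>n(x)\<close>.
\<close>

definition travel :: "nat \<Rightarrow> 'a \<Rightarrow> nat" where
  "travel n x = (\<Sum>i<n. p ((S ^^ i) x))"

lemma cantor: "cantor_space TYPE('a)"
  and homeo_T: "homeomorphic_map euclidean euclidean T"
  and dense_T: "closure (full_orbit T x) = UNIV"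
  using minimal_T by (auto simp: minimal_cantor_system_def all_orbits_dense_def)

lemma compact_UNIV: "compact (UNIV :: 'a set)"
  by (rule cantor_space_compact[OF cantor])

lemmas bij_T = homeomorphic_map_euclidean_bij[OF homeo_T]
  and bij_S = homeomorphic_map_euclidean_bij[OF homeo_S]
  and cont_T = homeomorphic_map_euclidean_continuous[OF homeo_T]
  and cont_S = homeomorphic_map_euclidean_continuous[OF homeo_S]
  and zpow_T_inj = minimal_cantor_system_aperiodic[OF minimal_T]

lemma P_pos: "P > 0"
  using p_pos p_le by (meson less_le_trans)

lemma travel_0 [simp]: "travel 0 x = 0"
  by (simp add: travel_def)

lemma travel_Suc: "travel (Suc n) x = travel n x + p ((S ^^ n) x)"
  by (simp add: travel_def)

lemma travel_Suc_0 [simp]: "travel (Suc 0) x = p x"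
  by (simp add: travel_def)

lemma travel_mono: "m \<le> n \<Longrightarrow> travel m x \<le> travel n x"
  unfolding travel_def by (intro sum_mono2) auto

lemma travel_strict_mono: "m < n \<Longrightarrow> travel m x < travel n x"
  using travel_mono[of "Suc m" n x] p_pos[of "(S ^^ m) x"] by (simp add: travel_Suc)

lemma le_travel: "n \<le> travel n x"
proof (induction n)
  case (Suc n)
  then show ?case
    using travel_strict_mono[of n "Suc n" x] by simp
qed simp

lemma funpow_S: "(S ^^ n) x = (T ^^ travel n x) x"
proof (induction n)
  case (Suc n)
  have "(S ^^ Suc n) x = (T ^^ p ((S ^^ n) x)) ((S ^^ n) x)"
    by (simp add: speedup_def)
  also have "\<dots> = (T ^^ (p ((S ^^ n) x) + travel n x)) x"
    by (simp add: Suc.IH[symmetric] funpow_add)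
  finally show ?case
    by (simp add: travel_Suc add.commute)
qed simp

text \<open>
  The intervals between consecutive visits of the \<open>S\<close>-orbit tile the positions below \<open>travel n x\<close>.
\<close>

lemma travel_decompose:
  assumes "s < travel n x"
  shows "\<exists>i<n. \<exists>r<p ((S ^^ i) x). s = travel i x + r"
  using assms
proof (induction n)
  case (Suc n)
  show ?case
  proof (cases "s < travel n x")
    case True
    then show ?thesis
      using Suc.IH less_SucI by blast
  next
    case False
    then have "s = travel n x + (s - travel n x)" "s - travel n x < p ((S ^^ n) x)"
      using Suc.prems by (auto simp: travel_Suc)
    then show ?thesis
      by blast
  qed
qed simp

text \<open>
  By aperiodicity the time \<open>p x\<close> can be read off from \<open>S x\<close>, so a level set of \<open>p\<close> is an equalizer of
  two continuous maps into a Hausdorff space.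
\<close>

lemma p_level_closed: "closed {x. p x = k}"
proof -
  have "{x. p x = k} = {x. S x = (T ^^ k) x}"
  proof -
    have "S x = (T ^^ k) x \<Longrightarrow> p x = k" for x
      using zpow_T_inj[of "int (p x)" x "int k"] by (simp add: zpow_of_nat speedup_def)
    then show ?thesis
      by (auto simp: speedup_def)
  qed
  moreover have "closedin euclidean {x \<in> topspace euclidean. S x = (T ^^ k) x}"
    by (rule closedin_continuous_maps_eq[OF cantor_space_Hausdorff[OF cantor]])
      (use cont_S continuous_on_funpow[OF cont_T] in auto)
  ultimately show ?thesis
    by simp
qed

lemma p_level_open: "open {x. p x = k}"
proof -
  have "- {x. p x = k} = (\<Union>l\<in>{..P} - {k}. {x. p x = l})"
    using p_le by auto
  then have "closed (- {x. p x = k})"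
    by (simp add: p_level_closed closed_UN)
  then show ?thesis
    by (simp add: open_closed)
qed

lemma continuous_p: "continuous_on UNIV p"
proof -
  have "open (p -` A)" for A
  proof -
    have "p -` A = (\<Union>k\<in>A. {x. p x = k})"
      by auto
    then show ?thesis
      by (simp add: p_level_open open_UN)
  qed
  then show ?thesis
    by (simp add: continuous_on_open_vimage)
qed

subsection \<open>The orbit number\<close>

text \<open>
  The distances \<open>j\<close> behind \<open>x\<close> at which there is a point of the \<open>T\<close>-orbit of \<open>x\<close> that \<open>S\<close> carries
  beyond \<open>x\<close>.
\<close>

definition crossings :: "'a \<Rightarrow> nat set" where
  "crossings x = {j. j < p (zpow T (- int j) x)}"

lemma crossings_subset: "crossings x \<subseteq> {..<P}"
  using p_le by (auto simp: crossings_def intro: less_le_trans)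

lemma finite_crossings: "finite (crossings x)"
  by (rule finite_subset[OF crossings_subset]) simp

lemma S_zpow: "S (zpow T a x) = zpow T (int (p (zpow T a x)) + a) x"
  using zpow_add[OF bij_T, of "int (p (zpow T a x))" a x] by (simp add: speedup_def zpow_of_nat)

lemma funpow_S_zpow: "(S ^^ n) (zpow T a x) = zpow T (int (travel n (zpow T a x)) + a) x"
  using zpow_add[OF bij_T, of "int (travel n (zpow T a x))" a x] by (simp add: funpow_S zpow_of_nat)

lemma S_in_full_orbit_iff: "S y \<in> full_orbit S z \<longleftrightarrow> y \<in> full_orbit S z"
proof -
  have "S y \<in> full_orbit S y"
    using zpow_in_full_orbit[of S 1 y] zpow_of_nat[of S 1 y] by simp
  then have "full_orbit S (S y) = full_orbit S y"
    by (rule full_orbit_eq[OF bij_S])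
  then show ?thesis
    using full_orbit_eq[OF bij_S] self_in_full_orbit by metis
qed

text \<open>
  Starting from \<open>y\<close>, move along its \<open>S\<close>-orbit: forwards as long as the next point is not beyond \<open>x\<close>,
  or backwards as long as the current point is beyond \<open>x\<close>. As \<open>p > 0\<close>, each step makes progress, so a
  crossing of \<open>x\<close> is reached.
\<close>

lemma crossing_exists:
  assumes "y \<in> full_orbit T x"
  shows "\<exists>j\<in>crossings x. y \<in> full_orbit S (zpow T (- int j) x)"
proof -
  let ?goal = "\<lambda>y. \<exists>j\<in>crossings x. y \<in> full_orbit S (zpow T (- int j) x)"
  have neg: "?goal (zpow T (- int k) x)" for k
  proof (induction k rule: less_induct)
    case (less k)
    let ?y = "zpow T (- int k) x"
    show ?case
    proof (cases "k < p ?y")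
      case True
      then show ?thesis
        by (intro bexI[of _ k] self_in_full_orbit) (simp add: crossings_def)
    next
      case False
      then have "S ?y = zpow T (- int (k - p ?y)) x"
        by (simp add: S_zpow of_nat_diff)
      moreover have "k - p ?y < k"
        using False p_pos[of ?y] by simp
      ultimately have "?goal (S ?y)"
        using less.IH by simp
      then show ?thesis
        by (simp add: S_in_full_orbit_iff)
    qed
  qed
  have pos: "?goal (zpow T (int k) x)" for k
  proof (induction k rule: less_induct)
    case (less k)
    let ?y = "zpow T (int k) x"
    define z where "z = inv S ?y"
    have Sz: "S z = ?y"
      using bij_S by (simp add: z_def bij_is_surj surj_f_inv_f)
    have "zpow T (int (p z)) z = ?y"
      using Sz by (simp add: speedup_def zpow_of_nat)
    then have z: "z = zpow T (int k - int (p z)) x"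
      using zpow_add[OF bij_T, of "- int (p z)" "int (p z)" z]
        zpow_add[OF bij_T, of "- int (p z)" "int k" x] by simp
    have "?goal z"
    proof (cases "p z \<le> k")
      case True
      then have "k = 0 \<or> k - p z < k" "z = zpow T (int (k - p z)) x"
        using p_pos[of z] z by (auto simp: of_nat_diff)
      then show ?thesis
        using less.IH[of "k - p z"] p_pos[of z] True by auto
    next
      case False
      then have "z = zpow T (- int (p z - k)) x"
        using z by (simp add: of_nat_diff)
      then show ?thesis
        using neg[of "p z - k"] by simp
    qed
    then show ?case
      using Sz S_in_full_orbit_iff by metis
  qed
  obtain a where y: "y = zpow T a x"
    using assms by (auto simp: full_orbit_eq_range_zpow)
  show ?thesis
    using neg[of "nat (- a)"] pos[of "nat a"] unfolding y by (cases "0 \<le> a") auto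
qed

text \<open>
  One step of \<open>S\<close> from a crossing point already lands beyond \<open>x\<close>, and \<open>S\<close> only moves further on, so the
  orbit does not meet a second crossing point.
\<close>

lemma crossing_unique_aux:
  assumes "j \<in> crossings x" "j' \<in> crossings x"
    and eq: "(S ^^ d) (zpow T (- int j') x) = zpow T (- int j) x"
  shows "d = 0 \<and> j = j'"
proof -
  have pos: "int (travel d (zpow T (- int j') x)) - int j' = - int j"
    using eq zpow_T_inj[of _ x "- int j"] by (simp add: funpow_S_zpow)
  have "d = 0"
  proof (rule ccontr)
    assume "d \<noteq> 0"
    then have "travel (Suc 0) (zpow T (- int j') x) \<le> travel d (zpow T (- int j') x)"
      by (intro travel_mono) simp
    then show False
      using pos assms(2) by (simp add: crossings_def)
  qed
  then show ?thesis
    using pos by simp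
qed

lemma crossing_unique:
  assumes "j \<in> crossings x" "j' \<in> crossings x"
    and eq: "(S ^^ i) (zpow T (- int j) x) = (S ^^ i') (zpow T (- int j') x)"
  shows "i = i' \<and> j = j'"
proof -
  have inj: "inj (S ^^ n)" for n
    using bij_S by (simp add: bij_is_inj inj_fn)
  have *: "a = b \<and> k = k'"
    if "a \<le> b" "k \<in> crossings x" "k' \<in> crossings x"
      and eq': "(S ^^ a) (zpow T (- int k) x) = (S ^^ b) (zpow T (- int k') x)" for a b k k'
  proof -
    have "(S ^^ a) (zpow T (- int k) x) = (S ^^ a) ((S ^^ (b - a)) (zpow T (- int k') x))"
      using eq' \<open>a \<le> b\<close> funpow_add[of a "b - a" S] by simp
    then have "(S ^^ (b - a)) (zpow T (- int k') x) = zpow T (- int k) x"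
      using inj[of a] by (simp add: inj_eq)
    then show ?thesis
      using crossing_unique_aux[OF that(2,3)] \<open>a \<le> b\<close> by fastforce
  qed
  show ?thesis
    using *[of i i' j j'] *[of i' i j' j] assms by (metis nat_le_linear)
qed

text \<open>
  Each \<open>S\<close>-orbit inside the \<open>T\<close>-orbit of \<open>x\<close> crosses \<open>x\<close> exactly once. The right-hand side depends only on the \<open>T\<close>-orbit of \<open>x\<close>, so this identity shows that the number of
  crossings is \<open>T\<close>-invariant without any computation.
\<close>

lemma card_crossings_eq: "card (crossings x) = card (full_orbit S ` full_orbit T x)"
proof (rule bij_betw_same_card)
  show "bij_betw (\<lambda>j. full_orbit S (zpow T (- int j) x)) (crossings x) (full_orbit S ` full_orbit T x)"
    unfolding bij_betw_def
  proof
    show "inj_on (\<lambda>j. full_orbit S (zpow T (- int j) x)) (crossings x)"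
    proof (rule inj_onI)
      fix j j'
      assume j: "j \<in> crossings x" "j' \<in> crossings x"
        and "full_orbit S (zpow T (- int j) x) = full_orbit S (zpow T (- int j') x)"
      then have "zpow T (- int j) x \<in> full_orbit S (zpow T (- int j') x)"
        using self_in_full_orbit by metis
      then obtain k where k: "zpow T (- int j) x = zpow S k (zpow T (- int j') x)"
        by (auto simp: full_orbit_eq_range_zpow)
      show "j = j'"
      proof (cases "0 \<le> k")
        case True
        then show ?thesis
          using crossing_unique[OF j, of 0 "nat k"] k by (simp add: zpow_def)
      next
        case False
        have "zpow S (- k) (zpow T (- int j) x) = zpow T (- int j') x"
          using k zpow_add[OF bij_S, of "- k" k "zpow T (- int j') x"] by simp
        then show ?thesis
          using crossing_unique[OF j, of "nat (- k)" 0] False by (simp add: zpow_def)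
      qed
    qed
    show "(\<lambda>j. full_orbit S (zpow T (- int j) x)) ` crossings x = full_orbit S ` full_orbit T x"
    proof
      show "(\<lambda>j. full_orbit S (zpow T (- int j) x)) ` crossings x \<subseteq> full_orbit S ` full_orbit T x"
        by (intro image_subsetI imageI zpow_in_full_orbit)
      show "full_orbit S ` full_orbit T x \<subseteq> (\<lambda>j. full_orbit S (zpow T (- int j) x)) ` crossings x"
      proof
        fix A assume "A \<in> full_orbit S ` full_orbit T x"
        then obtain y where A: "A = full_orbit S y" and y: "y \<in> full_orbit T x"
          by blast
        obtain j where "j \<in> crossings x" "y \<in> full_orbit S (zpow T (- int j) x)"
          using crossing_exists[OF y] by blast
        then show "A \<in> (\<lambda>j. full_orbit S (zpow T (- int j) x)) ` crossings x"
          unfolding A by (intro rev_image_eqI[of j]) (simp_all add: full_orbit_eq[OF bij_S])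
      qed
    qed
  qed
qed

text \<open>
  The number of crossings is a finite sum of locally constant functions of \<open>x\<close>, and it is constant on
  \<open>T\<close>-orbits, which are dense.
\<close>

lemma card_crossings_const: "card (crossings x) = card (crossings y)"
proof -
  define F where "F x = (\<Sum>j<P. of_bool (j < p (zpow T (- int j) x)) :: real)" for x
  have F: "F x = real (card (crossings x))" for x
  proof -
    have "{..<P} \<inter> {j. j < p (zpow T (- int j) x)} = crossings x"
      using crossings_subset[of x] by (auto simp: crossings_def)
    then show ?thesis
      by (simp add: F_def of_bool_def sum.If_cases)
  qed
  have "continuous_on UNIV F"
    unfolding F_def
  proof (intro continuous_on_sum)
    fix j
    have "continuous_on UNIV (\<lambda>x. p (zpow T (- int j) x))"
      by (rule continuous_on_compose2[OF continuous_p continuous_on_zpow[OF homeo_T]]) simp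
    then show "continuous_on UNIV (\<lambda>x. of_bool (j < p (zpow T (- int j) x)) :: real)"
      by (rule continuous_on_compose2[where g="\<lambda>n. of_bool (j < n)", rotated])
        (auto intro: continuous_on_discrete)
  qed
  then have "closed (F -` {F y})"
    by (intro closed_vimage) auto
  moreover have "full_orbit T y \<subseteq> F -` {F y}"
    using full_orbit_eq[OF bij_T] by (auto simp: F card_crossings_eq)
  ultimately have "F -` {F y} = UNIV"
    using closure_minimal dense_T by (metis top.extremum_unique)
  then have "F x = F y"
    by blast
  then show ?thesis
    by (simp add: F)
qed

lemma card_crossings_pos: "card (crossings x) > 0"
  using crossing_exists[OF self_in_full_orbit, of x] finite_crossings by (auto simp: card_gt_0_iff)

text \<open>
  The \<open>S\<close>-orbits partition the space and refine the \<open>T\<close>-orbits, so a family of \<open>S\<close>-orbits with union the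
  \<open>T\<close>-orbit of \<open>x\<close> has to consist of all the \<open>S\<close>-orbits contained in it. This makes the
  number in the definite description unique.
\<close>

proposition orbit_number_eq_card_crossings: "orbit_number T S = card (crossings x)"
  unfolding orbit_number_def
proof (rule the_equality)
  have Union: "full_orbit T y = \<Union> (full_orbit S ` full_orbit T y)" for y
  proof
    show "full_orbit T y \<subseteq> \<Union> (full_orbit S ` full_orbit T y)"
      using self_in_full_orbit by fastforce
    have "full_orbit S z \<subseteq> full_orbit T z" for z
    proof -
      have S_T: "zpow S (int n) w \<in> full_orbit T w" for n w
        using zpow_in_full_orbit[of T "int (travel n w)" w] by (simp add: zpow_of_nat funpow_S)
      have "zpow S k z \<in> full_orbit T z" for k
      proof (cases "0 \<le> k")
        case True
        then show ?thesis using S_T[of "nat k" z] by simp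
      next
        case False
        then have "z \<in> full_orbit T (zpow S k z)"
          using S_T[of "nat (- k)" "zpow S k z"] zpow_add[OF bij_S, of "- k" k z] by simp
        then show ?thesis
          using full_orbit_eq[OF bij_T] self_in_full_orbit by metis
      qed
      then show ?thesis
        by (auto simp: full_orbit_eq_range_zpow[of S])
    qed
    then show "\<Union> (full_orbit S ` full_orbit T y) \<subseteq> full_orbit T y"
      using full_orbit_eq[OF bij_T] by fastforce
  qed
  have fin: "finite (full_orbit S ` full_orbit T y)" for y
    using card_crossings_pos[of y] card_crossings_eq[of y] by (simp add: card_gt_0_iff)
  show "is_orbit_number T S (card (crossings x))"
    unfolding is_orbit_number_def
  proof (intro conjI allI)
    fix y
    show "\<exists>F\<subseteq>range (full_orbit S). finite F \<and> card F = card (crossings x) \<and> full_orbit T y = \<Union> F"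
      using Union[of y] fin[of y] card_crossings_eq[of y] card_crossings_const[of x y]
      by (intro exI[of _ "full_orbit S ` full_orbit T y"]) auto
  qed (rule card_crossings_pos)
  fix c assume "is_orbit_number T S c"
  then obtain F where F: "F \<subseteq> range (full_orbit S)" "card F = c" "full_orbit T x = \<Union> F"
    unfolding is_orbit_number_def by blast
  have "F = full_orbit S ` full_orbit T x"
  proof
    show "F \<subseteq> full_orbit S ` full_orbit T x"
    proof
      fix A assume "A \<in> F"
      then obtain z where z: "A = full_orbit S z"
        using F(1) by blast
      then have "z \<in> full_orbit T x"
        using \<open>A \<in> F\<close> F(3) self_in_full_orbit[of z S] by blast
      with z show "A \<in> full_orbit S ` full_orbit T x"
        by blast
    qed
    show "full_orbit S ` full_orbit T x \<subseteq> F"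
    proof
      fix A assume "A \<in> full_orbit S ` full_orbit T x"
      then obtain y B where y: "A = full_orbit S y" "y \<in> B" "B \<in> F"
        unfolding F(3) by blast
      obtain z where "B = full_orbit S z"
        using y(3) F(1) by blast
      then show "A \<in> F"
        using full_orbit_eq[OF bij_S, of y z] y by simp
    qed
  qed
  then show "c = card (crossings x)"
    using F(2) card_crossings_eq by simp
qed

subsection \<open>Comparing orbit names\<close>

text \<open>
  Knowing which member of this cover contains \<open>x\<close> determines \<open>p x\<close> and locates
  \<open>x, Tx, \<dots>, T\<^sup>P\<^sup>-\<^sup>1x\<close> in \<open>\<U>\<close>, hence the whole \<open>T\<close>-segment from \<open>x\<close> up to \<open>S x\<close>.
\<close>

definition refined_cover :: "'a set set \<Rightarrow> 'a set set" where
  "refined_cover \<U> =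
    {A. open A \<and> (\<exists>k. \<forall>x\<in>A. p x = k) \<and> (\<forall>r<P. \<exists>B\<in>\<U>. (T ^^ r) ` A \<subseteq> B)}"

lemma open_cover_refined_cover:
  assumes "open_cover \<U>"
  shows "open_cover (refined_cover \<U>)"
  unfolding open_cover_def
proof
  show "\<forall>A\<in>refined_cover \<U>. open A"
    by (simp add: refined_cover_def)
  have "\<exists>A\<in>refined_cover \<U>. x \<in> A" for x
  proof -
    have "\<forall>r. \<exists>B\<in>\<U>. (T ^^ r) x \<in> B"
      using assms by (auto simp: open_cover_def)
    then obtain B where B: "\<And>r. B r \<in> \<U> \<and> (T ^^ r) x \<in> B r"
      by metis
    define A where "A = {y. p y = p x} \<inter> (\<Inter>r<P. (T ^^ r) -` B r)"
    have "open (B r)" for r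
      using B assms by (auto simp: open_cover_def)
    then have "open A"
      unfolding A_def
      by (intro open_Int p_level_open open_INT ballI open_vimage continuous_on_funpow[OF cont_T]) auto
    moreover have "\<forall>y\<in>A. p y = p x"
      by (simp add: A_def)
    moreover have "\<exists>C\<in>\<U>. (T ^^ r) ` A \<subseteq> C" if "r < P" for r
      using that B[of r] by (intro bexI[of _ "B r"]) (auto simp: A_def)
    ultimately have "A \<in> refined_cover \<U>"
      unfolding refined_cover_def by blast
    moreover have "x \<in> A"
      using B by (simp add: A_def)
    ultimately show ?thesis ..
  qed
  then show "\<Union> (refined_cover \<U>) = UNIV"
    by blast
qed

lemma refined_coverE:
  assumes "A \<in> refined_cover \<U>" "r < P"
  obtains B where "B \<in> \<U>" "\<And>x. x \<in> A \<Longrightarrow> (T ^^ r) x \<in> B"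
  using assms unfolding refined_cover_def by blast

lemma refined_cover_p_eq:
  "A \<in> refined_cover \<U> \<Longrightarrow> x \<in> A \<Longrightarrow> y \<in> A \<Longrightarrow> p x = p y"
  unfolding refined_cover_def by force

text \<open>
  A pigeonhole argument. If all crossing points were slow, the first \<open>n\<close> iterates under \<open>S\<close> of all of
  them would occupy distinct positions strictly between \<open>0\<close> and \<open>m\<close>; there are
  \<open>card (crossings x) * n \<ge> m\<close> such iterates but only \<open>m - 1\<close> such positions.
\<close>

lemma long_crossing:
  assumes m: "0 < m" "m \<le> card (crossings x) * n"
  shows "\<exists>j\<in>crossings x. m + j \<le> travel n (zpow T (- int j) x)"
proof (rule ccontr)
  assume "\<not> ?thesis"
  then have short: "travel n (zpow T (- int j) x) < m + j" if "j \<in> crossings x" for j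
    using that by (auto simp: not_le)
  define pos where "pos = (\<lambda>(j, i). travel i (zpow T (- int j) x) - j)"
  have gt: "j < travel i (zpow T (- int j) x)" if "j \<in> crossings x" "i \<in> {1..n}" for i j
    using that travel_mono[of "Suc 0" i "zpow T (- int j) x"] by (simp add: crossings_def)
  have "pos ` (crossings x \<times> {1..n}) \<subseteq> {1..<m}"
  proof safe
    fix j i assume ji: "j \<in> crossings x" "i \<in> {1..n}"
    then have "travel i (zpow T (- int j) x) < m + j"
      using short[of j] travel_mono[of i n "zpow T (- int j) x"] by simp
    then show "pos (j, i) \<in> {1..<m}"
      using gt[OF ji] by (simp add: pos_def) linarith
  qed
  moreover have "inj_on pos (crossings x \<times> {1..n})"
  proof (rule inj_onI, clarify)
    fix j i j' i'
    assume ji: "j \<in> crossings x" "i \<in> {1..n}" "j' \<in> crossings x" "i' \<in> {1..n}"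
      and "pos (j, i) = pos (j', i')"
    then have "int (travel i (zpow T (- int j) x)) + - int j
        = int (travel i' (zpow T (- int j') x)) + - int j'"
      using gt[of j i] gt[of j' i'] by (simp add: pos_def)
    then have "(S ^^ i) (zpow T (- int j) x) = (S ^^ i') (zpow T (- int j') x)"
      unfolding funpow_S_zpow by simp
    then show "j = j' \<and> i = i'"
      using crossing_unique[OF ji(1,3)] by simp
  qed
  ultimately have "card (crossings x \<times> {1..n}) \<le> card {1..<m}"
    by (metis card_image card_mono finite_atLeastLessThan)
  then show False
    using m by (simp add: card_cartesian_product)
qed

text \<open>
  Every \<open>x\<close> has the form \<open>T\<^sup>jy\<close> with \<open>j < P\<close> and \<open>y\<close> a crossing point whose \<open>n\<close> steps of \<open>S\<close> pass over
  the whole segment \<open>x, \<dots>, T\<^sup>m\<^sup>-\<^sup>1x\<close>. The \<open>S\<close>-name of \<open>y\<close> and the number \<open>j\<close> determine a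
  \<open>T\<close>-name of \<open>x\<close>. The crossing points lie behind \<open>x\<close> so that no initial part of this segment is missed.
\<close>

lemma min_subcover_card_join_T_le:
  assumes \<U>: "open_cover \<U>" and m: "0 < m" "m \<le> orbit_number T S * n"
  shows "min_subcover_card (cover_join T \<U> m)
    \<le> P * min_subcover_card (cover_join S (refined_cover \<U>) n)"
proof -
  obtain \<V> where \<V>: "\<V> \<subseteq> cover_join S (refined_cover \<U>) n" "finite \<V>"
    "card \<V> = min_subcover_card (cover_join S (refined_cover \<U>) n)" "\<Union> \<V> = UNIV"
    using min_subcover_card_attained[OF compact_UNIV
        open_cover_cover_join[OF cont_S open_cover_refined_cover[OF \<U>]]] by blast
  define W where "W = (\<lambda>(j, V). {x. \<exists>y\<in>V. x = (T ^^ j) y \<and> m + j \<le> travel n y})"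
  have "min_subcover_card (cover_join T \<U> m) \<le> card ({..<P} \<times> \<V>)"
  proof (rule min_subcover_card_le[where W=W])
    show "finite ({..<P} \<times> \<V>)"
      using \<V>(2) by simp
    have "\<exists>a\<in>{..<P} \<times> \<V>. x \<in> W a" for x
    proof -
      have "m \<le> card (crossings x) * n"
        using m(2) orbit_number_eq_card_crossings[of x] by simp
      then obtain j where j: "j \<in> crossings x" "m + j \<le> travel n (zpow T (- int j) x)"
        using long_crossing[OF m(1)] by blast
      obtain V where "V \<in> \<V>" "zpow T (- int j) x \<in> V"
        using \<V>(4) by blast
      moreover have "(T ^^ j) (zpow T (- int j) x) = x"
        using zpow_add[OF bij_T, of "int j" "- int j" x] by (simp add: zpow_of_nat)
      ultimately have "x \<in> W (j, V)"
        using j(2) by (auto simp: W_def intro!: bexI[of _ "zpow T (- int j) x"])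
      then show ?thesis
        using j(1) crossings_subset \<open>V \<in> \<V>\<close> by (intro bexI[of _ "(j, V)"]) auto
    qed
    then show "(\<Union>a\<in>{..<P} \<times> \<V>. W a) = UNIV"
      by blast
    fix a assume a: "a \<in> {..<P} \<times> \<V>" "W a \<noteq> {}"
    obtain j V where jV: "a = (j, V)" "V \<in> \<V>"
      using a(1) by blast
    obtain y0 where y0: "y0 \<in> V" "m + j \<le> travel n y0"
      using a(2) by (auto simp: W_def jV)
    obtain A where A: "\<And>i. i < n \<Longrightarrow> A i \<in> refined_cover \<U>" "V = (\<Inter>i<n. (S ^^ i) -` A i)"
      using jV(2) \<V>(1) unfolding cover_join_def by blast
    \<comment> \<open>All points of \<open>V\<close> make the same jumps, so the reference point \<open>y0\<close> decides once and for all
      which \<open>i\<close> and \<open>r\<close> belong to a time \<open>t\<close>.\<close>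
    have same_travel: "travel i y = travel i y0" if "y \<in> V" "i \<le> n" for y i
      unfolding travel_def
    proof (rule sum.cong)
      fix l assume "l \<in> {..<i}"
      then show "p ((S ^^ l) y) = p ((S ^^ l) y0)"
        using that y0(1) A(2) by (intro refined_cover_p_eq[OF A(1)[of l]]) auto
    qed simp
    have "\<exists>B\<in>\<U>. \<forall>x\<in>W a. (T ^^ t) x \<in> B" if "t < m" for t
    proof -
      obtain i r where ir: "i < n" "r < p ((S ^^ i) y0)" "t + j = travel i y0 + r"
        using travel_decompose[of "t + j" n y0] \<open>t < m\<close> y0(2) by auto
      have "r < P"
        using ir(2) p_le less_le_trans by blast
      then obtain B where B: "B \<in> \<U>" "\<And>z. z \<in> A i \<Longrightarrow> (T ^^ r) z \<in> B"
        using refined_coverE[OF A(1)[OF ir(1)]] by blast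
      have "(T ^^ t) x \<in> B" if x: "x \<in> W a" for x
      proof -
        obtain y where y: "y \<in> V" "x = (T ^^ j) y"
          using x by (auto simp: W_def jV)
        have "t + j = r + travel i y"
          using same_travel[OF y(1), of i] ir by simp
        then have "(T ^^ t) x = (T ^^ (r + travel i y)) y"
          using y(2) by (metis comp_apply funpow_add)
        also have "\<dots> = (T ^^ r) ((S ^^ i) y)"
          by (simp add: funpow_add funpow_S)
        also have "\<dots> \<in> B"
          using y(1) A(2) ir(1) by (intro B(2)) auto
        finally show ?thesis .
      qed
      with B(1) show ?thesis
        by blast
    qed
    then obtain B where B: "\<And>t. t < m \<Longrightarrow> B t \<in> \<U> \<and> (\<forall>x\<in>W a. (T ^^ t) x \<in> B t)"
      by metis
    show "\<exists>C\<in>cover_join T \<U> m. W a \<subseteq> C"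
    proof (rule bexI)
      show "(\<Inter>t<m. (T ^^ t) -` B t) \<in> cover_join T \<U> m"
        using B unfolding cover_join_def by blast
      show "W a \<subseteq> (\<Inter>t<m. (T ^^ t) -` B t)"
        using B by auto
    qed
  qed
  then show ?thesis
    by (simp add: card_cartesian_product \<V>(3))
qed

text \<open>
  A \<open>T\<close>-name in the refined cover reveals the jump at each position, so following the jumps through a
  \<open>T\<close>-name of length \<open>m\<close> gives the \<open>S\<close>-name, as long as \<open>n\<close> jumps do not leave it.
\<close>

lemma min_subcover_card_join_S_le:
  assumes \<U>: "open_cover \<U>" and m: "\<And>x. travel n x \<le> m"
  shows "min_subcover_card (cover_join S \<U> n) \<le> min_subcover_card (cover_join T (refined_cover \<U>) m)"
proof -
  obtain \<V> where \<V>: "\<V> \<subseteq> cover_join T (refined_cover \<U>) m" "finite \<V>"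
    "card \<V> = min_subcover_card (cover_join T (refined_cover \<U>) m)" "\<Union> \<V> = UNIV"
    using min_subcover_card_attained[OF compact_UNIV
        open_cover_cover_join[OF cont_T open_cover_refined_cover[OF \<U>]]] by blast
  have "min_subcover_card (cover_join S \<U> n) \<le> card \<V>"
  proof (rule min_subcover_card_le[where W="\<lambda>V. V"])
    fix V assume V: "V \<in> \<V>" "V \<noteq> {}"
    obtain y0 where y0: "y0 \<in> V"
      using V(2) by blast
    obtain A where A: "\<And>t. t < m \<Longrightarrow> A t \<in> refined_cover \<U>" "V = (\<Inter>t<m. (T ^^ t) -` A t)"
      using V(1) \<V>(1) unfolding cover_join_def by blast
    have lt: "travel i y0 < m" if "i < n" for i
      using travel_strict_mono[OF that, of y0] m[of y0] by simp
    have same_travel: "travel i y = travel i y0" if "y \<in> V" "i \<le> n" for y i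
      using that(2)
    proof (induction i)
      case (Suc i)
      then have IH: "travel i y = travel i y0" and "travel i y0 < m"
        using lt by auto
      then have "p ((S ^^ i) y) = p ((S ^^ i) y0)"
        using \<open>y \<in> V\<close> y0 A(2) by (intro refined_cover_p_eq[OF A(1)]) (auto simp: funpow_S)
      then show ?case
        by (simp add: travel_Suc IH)
    qed simp
    have "\<exists>B\<in>\<U>. \<forall>y\<in>V. (S ^^ i) y \<in> B" if "i < n" for i
    proof -
      obtain B where B: "B \<in> \<U>" "\<And>z. z \<in> A (travel i y0) \<Longrightarrow> (T ^^ 0) z \<in> B"
        using refined_coverE[OF A(1)[OF lt[OF \<open>i < n\<close>]] P_pos] by blast
      have "(S ^^ i) y \<in> B" if "y \<in> V" for y
        using B(2)[of "(S ^^ i) y"] that same_travel[OF that, of i] \<open>i < n\<close> lt[OF \<open>i < n\<close>] A(2)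
        by (simp add: funpow_S)
      with B(1) show ?thesis
        by blast
    qed
    then obtain B where B: "\<And>i. i < n \<Longrightarrow> B i \<in> \<U> \<and> (\<forall>y\<in>V. (S ^^ i) y \<in> B i)"
      by metis
    show "\<exists>C\<in>cover_join S \<U> n. V \<subseteq> C"
    proof (rule bexI)
      show "(\<Inter>i<n. (S ^^ i) -` B i) \<in> cover_join S \<U> n"
        using B unfolding cover_join_def by blast
      show "V \<subseteq> (\<Inter>i<n. (S ^^ i) -` B i)"
        using B by auto
    qed
  qed (use \<V> in auto)
  then show ?thesis
    by (simp add: \<V>(3))
qed

subsection \<open>The two entropy inequalities\<close>

lemma orbit_number_pos: "orbit_number T S > 0"
  using orbit_number_eq_card_crossings card_crossings_pos by simp

proposition orbit_number_entropy_le: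
  "ereal (real (orbit_number T S)) * topological_entropy T \<le> topological_entropy S"
proof -
  define c where "c = orbit_number T S"
  have c: "c > 0"
    using orbit_number_pos by (simp add: c_def)
  \<comment> \<open>The length of \<open>S\<close>-name needed for a \<open>T\<close>-name of length \<open>m\<close>: it satisfies \<open>m \<le> c * \<phi> m\<close>.\<close>
  define \<phi> where "\<phi> m = m div c + 1" for m
  have \<phi>: "(\<lambda>m. real (\<phi> m) / real m) \<longlonglongrightarrow> 1 / real c"
  proof (rule tendsto_sandwich)
    show "\<forall>\<^sub>F m in sequentially. 1 / real c \<le> real (\<phi> m) / real m"
      using eventually_gt_at_top[of 0]
    proof eventually_elim
      case (elim m)
      have "m < c * (m div c) + c"
        using dividend_less_times_div[OF c, of m] by simp
      then have "real m \<le> real c * real (\<phi> m)"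
        by (simp add: \<phi>_def algebra_simps flip: of_nat_mult of_nat_add)
      then show ?case
        using c elim by (simp add: field_simps)
    qed
    show "\<forall>\<^sub>F m in sequentially. real (\<phi> m) / real m \<le> 1 / real c + 1 / real m"
      using eventually_gt_at_top[of 0]
    proof eventually_elim
      case (elim m)
      have "c * (m div c) \<le> m"
        by simp
      then have "real c * real (m div c) \<le> real m"
        by (simp flip: of_nat_mult)
      then have "real (m div c) \<le> real m / real c"
        using c by (simp add: field_simps)
      then show ?case
        using c elim by (simp add: \<phi>_def field_simps)
    qed
    show "(\<lambda>m. 1 / real c + 1 / real m) \<longlonglongrightarrow> 1 / real c"
      using tendsto_add[OF tendsto_const lim_const_over_n[of 1]] by simp
  qed simp
  have "cover_entropy T \<U> \<le> ereal (1 / real c) * topological_entropy S" if \<U>: "open_cover \<U>" for \<U>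
  proof -
    have "cover_entropy T \<U> \<le> ereal (1 / real c) * cover_entropy S (refined_cover \<U>)"
    proof (rule cover_entropy_le[OF _ \<phi>])
      show "\<forall>\<^sub>F m in sequentially. min_subcover_card (cover_join T \<U> m)
          \<le> P * min_subcover_card (cover_join S (refined_cover \<U>) (\<phi> m))"
        using eventually_gt_at_top[of 0]
      proof eventually_elim
        case (elim m)
        have "m \<le> c * \<phi> m"
          using dividend_less_times_div[OF c, of m] by (simp add: \<phi>_def)
        then show ?case
          using min_subcover_card_join_T_le[OF \<U> elim] by (simp add: c_def)
      qed
    qed (use c in simp)
    also have "\<dots> \<le> ereal (1 / real c) * topological_entropy S"
      unfolding topological_entropy_def using open_cover_refined_cover[OF \<U>]
      by (intro ereal_mult_left_mono SUP_upper) auto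
    finally show ?thesis .
  qed
  then have "topological_entropy T \<le> ereal (1 / real c) * topological_entropy S"
    unfolding topological_entropy_def[of T] by (intro SUP_least) simp
  then have "ereal (real c) * topological_entropy T
      \<le> ereal (real c) * (ereal (1 / real c) * topological_entropy S)"
    by (intro ereal_mult_left_mono) auto
  also have "\<dots> = topological_entropy S"
    using c by (simp flip: mult.assoc)
  finally show ?thesis
    by (simp add: c_def)
qed

lemma exists_invariant_measure_integral_ge:
  assumes "\<And>N. \<exists>n\<ge>N. \<exists>x. a * real n \<le> real (travel n x)"
  shows "\<exists>\<mu>\<in>invariant_measures S. a \<le> (\<integral>x. real (p x) \<partial>\<mu>)"
proof (rule invariant_measure_with_large_integral[OF cantor cont_S _ p_le])
  show "{y. p y = k} \<in> clopens" for k
    by (simp add: clopens_def p_level_open p_level_closed)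
  show "\<exists>n\<ge>N. \<exists>x. a * real n \<le> (\<Sum>i<n. real (p ((S ^^ i) x)))" for N
    using assms[of N] by (simp add: travel_def)
qed

text \<open>
  This keeps the supremum of the integrals finite, so that it can be approximated from above by real
  numbers.
\<close>

lemma integral_p_le:
  assumes "\<mu> \<in> invariant_measures S"
  shows "(\<integral>x. real (p x) \<partial>\<mu>) \<le> real P"
proof -
  interpret prob_space \<mu>
    using assms by (simp add: invariant_measures_def)
  show ?thesis
  proof (cases "integrable \<mu> (\<lambda>x. real (p x))")
    case True
    then show ?thesis
      using p_le by (intro integral_le_const) auto
  next
    case False
    then show ?thesis
      by (simp add: not_integrable_integral_eq)
  qed
qed

lemma entropy_S_le:
  assumes \<kappa>: "\<kappa> > 0"
    and travel: "\<forall>\<^sub>F n in sequentially. \<forall>x. real (travel n x) \<le> \<kappa> * real n"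
  shows "topological_entropy S \<le> ereal \<kappa> * topological_entropy T"
  unfolding topological_entropy_def[of S]
proof (rule SUP_least)
  fix \<U> :: "'a set set" assume "\<U> \<in> Collect open_cover"
  then have \<U>: "open_cover \<U>" by simp
  define \<phi> where "\<phi> n = nat \<lfloor>\<kappa> * real n\<rfloor>" for n
  have \<phi>: "(\<lambda>n. real (\<phi> n) / real n) \<longlonglongrightarrow> \<kappa>"
  proof (rule tendsto_sandwich)
    have fl: "real (\<phi> n) \<le> \<kappa> * real n" "\<kappa> * real n - 1 \<le> real (\<phi> n)" for n
      using \<kappa> by (auto simp: \<phi>_def)
    show "\<forall>\<^sub>F n in sequentially. \<kappa> - 1 / real n \<le> real (\<phi> n) / real n"
      using eventually_gt_at_top[of 0]
    proof eventually_elim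
      case (elim n)
      then show ?case
        using divide_right_mono[OF fl(2)[of n], of "real n"] by (simp add: diff_divide_distrib)
    qed
    show "\<forall>\<^sub>F n in sequentially. real (\<phi> n) / real n \<le> \<kappa>"
      using eventually_gt_at_top[of 0]
    proof eventually_elim
      case (elim n)
      then show ?case
        using fl(1)[of n] by (simp add: field_simps)
    qed
    show "(\<lambda>n. \<kappa> - 1 / real n) \<longlonglongrightarrow> \<kappa>"
      using tendsto_diff[OF tendsto_const lim_const_over_n[of 1]] by simp
  qed simp
  have "cover_entropy S \<U> \<le> ereal \<kappa> * cover_entropy T (refined_cover \<U>)"
  proof (rule cover_entropy_le[OF \<kappa> \<phi>])
    show "\<forall>\<^sub>F n in sequentially. min_subcover_card (cover_join S \<U> n)
        \<le> 1 * min_subcover_card (cover_join T (refined_cover \<U>) (\<phi> n))"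
      using travel
    proof eventually_elim
      case (elim n)
      have "travel n x \<le> \<phi> n" for x
        using elim by (simp add: \<phi>_def le_nat_floor)
      then show ?case
        using min_subcover_card_join_S_le[OF \<U>] by simp
    qed
  qed
  also have "\<dots> \<le> ereal \<kappa> * topological_entropy T"
    unfolding topological_entropy_def using open_cover_refined_cover[OF \<U>] \<kappa>
    by (intro ereal_mult_left_mono SUP_upper) auto
  finally show "cover_entropy S \<U> \<le> ereal \<kappa> * topological_entropy T" .
qed

text \<open>
  Every real \<open>\<kappa>\<close> above the supremum \<open>k\<close> satisfies the hypothesis of \<open>entropy_S_le\<close>, and then \<open>\<kappa>\<close> tends
  to \<open>k\<close>. That limit is taken only when \<open>h(T)\<close> is finite; otherwise the right-hand side is infinite because
  \<open>k \<ge> 1\<close>.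
\<close>

proposition entropy_le_sup_integral:
  "topological_entropy S
    \<le> (SUP \<mu> \<in> invariant_measures S. ereal (\<integral>x. real (p x) \<partial>\<mu>)) * topological_entropy T"
    (is "_ \<le> ?K * _")
proof -
  \<comment> \<open>As \<open>p \<ge> 1\<close>, every average of \<open>p\<close> is at least \<open>1\<close>; in particular, an invariant measure exists.\<close>
  have "\<exists>\<mu>\<in>invariant_measures S. 1 \<le> (\<integral>x. real (p x) \<partial>\<mu>)"
    by (rule exists_invariant_measure_integral_ge) (use le_travel in auto)
  then have K1: "1 \<le> ?K"
    by (auto intro: SUP_upper2)
  have "?K \<le> ereal (real P)"
    by (intro SUP_least) (simp add: integral_p_le)
  with K1 obtain k where k: "?K = ereal k" "1 \<le> k"
    by (cases ?K) auto
  have le: "topological_entropy S \<le> ereal \<kappa> * topological_entropy T" if "k < \<kappa>" for \<kappa>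
  proof (rule entropy_S_le)
    show "\<kappa> > 0"
      using that k(2) by simp
    show "\<forall>\<^sub>F n in sequentially. \<forall>x. real (travel n x) \<le> \<kappa> * real n"
    proof (rule ccontr)
      assume "\<not> ?thesis"
      then have "\<exists>n\<ge>N. \<exists>x. \<kappa> * real n \<le> real (travel n x)" for N
        unfolding eventually_sequentially by (meson less_imp_le not_le)
      then obtain \<mu> where "\<mu> \<in> invariant_measures S" "\<kappa> \<le> (\<integral>x. real (p x) \<partial>\<mu>)"
        using exists_invariant_measure_integral_ge by blast
      then have "ereal \<kappa> \<le> ?K"
        by (intro SUP_upper2) auto
      then show False
        using k(1) that by simp
    qed
  qed
  show ?thesis
  proof (cases "topological_entropy T")
    case (real h)
    have h: "0 \<le> h"
      using topological_entropy_nonneg[of T] real by simp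
    have "topological_entropy S \<le> ?K * topological_entropy T + ereal e" if "e > 0" for e
    proof -
      have "topological_entropy S \<le> ereal (k + e / (h + 1)) * topological_entropy T"
        using that h by (intro le) simp
      also have "\<dots> \<le> ereal (k * h + e)"
        using that h by (simp add: real field_simps)
      finally show ?thesis
        by (simp add: k(1) real)
    qed
    then show ?thesis
      by (rule ereal_le_epsilon2)
  next
    case PInf
    then show ?thesis
      using k by simp
  next
    case MInf
    then show ?thesis
      using topological_entropy_nonneg[of T] by simp
  qed
qed

end

theorem theorem2p12:
  fixes T :: "'a::topological_space \<Rightarrow> 'a" and p :: "'a \<Rightarrow> nat"
  assumes "minimal_cantor_system T"
    and "\<And>x. p x > 0"
    and "bounded (range p)"
    and "homeomorphic_map euclidean euclidean (speedup T p)"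
    and "all_orbits_dense (speedup T p)"
  shows "ereal (real (orbit_number T (speedup T p))) * topological_entropy T
           \<le> topological_entropy (speedup T p)
       \<and> topological_entropy (speedup T p)
           \<le> (SUP \<mu> \<in> invariant_measures (speedup T p). ereal (\<integral>x. real (p x) \<partial>\<mu>))
               * topological_entropy T"
proof -
  obtain e where "real (p x) \<le> e" for x
    using assms(3) by (auto simp: bounded_iff)
  then have "p x \<le> nat \<lfloor>e\<rfloor>" for x
    by (simp add: le_nat_floor)
  then interpret bounded_speedup T p "nat \<lfloor>e\<rfloor>"
    using assms by unfold_locales
  show ?thesis
    using orbit_number_entropy_le entropy_le_sup_integral ..
qed

end
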